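(* Let $n=d+m(d-2)$ with integers $d\ge 3$ and $m\in\mathbb{N}_0$, and let $\mathcal{T}$ be a $d$-angulation of the convex $n$-gon $\mathcal{P}_n$. Then $\widetilde{M}_\mathcal{T}=M_\mathcal{T}$. In particular, $\widetilde{M}_\mathcal{T}$ is symmetric.
   Context: $\mathcal{P}_n$ has vertices $1,\dots,n$ in counterclockwise order, labels modulo $n$; a $d$-angulation is a dissection by pairwise non-crossing diagonals into $d$-gons. For vertices $i,j$, a (counterclockwise) $d$-path from $i$ to $j$ is a sequence $p_{i+1},\dots,p_{j-1}$ of $d$-gons of $\mathcal{T}$, indexed by the vertices met strictly between $i$ and $j$ going counterclockwise from $i$ to $j$ (empty if $j=i+1$; the $n-1$ vertices other than $i$ if $j=i$), such that (i) $p_k$ is incident to vertex $k$ for each such $k$ and (ii) each $d$-gon appears at most $d-2$ times; $m_{i,j}$ is the number of such $d$-paths and $M_\mathcal{T}=(m_{i,j})$. The matrix $\widetilde{M}_\mathcal{T}=(\widetilde{m}_{i,j})_{1\le i,j\le n}$ is defined as follows: fix a vertex $i$; set $\widetilde{m}_{i,i}=0$ and $\widetilde{m}_{i,j}=1$ for every vertex $j\neq i$ lying in a common $d$-gon of $\mathcal{T}$ with $i$; then, inductively, whenever a $d$-gon $\alpha$ of $\mathcal{T}$ has two vertices $k,\ell$ for which $\widetilde{m}_{i,k},\widetilde{m}_{i,\ell}$ have already been assigned, set $\widetilde{m}_{i,v}=\widetilde{m}_{i,k}+\widetilde{m}_{i,\ell}$ for every other vertex $v$ of $\alpha$ (this procedure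 is well defined and assigns a value to every vertex). *)

theory Defs
  imports "Jordan_Normal_Form.Matrix"
begin

text \<open>
  The convex polygon with \<open>n\<close> vertices is treated combinatorially: its vertices are \<open>1, \<dots>, n\<close> in
  counterclockwise order, a diagonal is a two-element set of vertices, and a subpolygon is its set
  of vertices.
\<close>

text \<open>The vertices met strictly between \<open>i\<close> and \<open>j\<close> going counterclockwise from \<open>i\<close> to \<open>j\<close>;
  for \<open>j = i\<close> these are all the vertices other than \<open>i\<close>.\<close>

definition between :: "nat \<Rightarrow> nat \<Rightarrow> nat \<Rightarrow> nat set" where
  "between n i j = (if i < j then {i<..<j} else {i<..n} \<union> {1..<j})"

definition polygon_edges :: "nat \<Rightarrow> nat set set" where
  "polygon_edges n = {{i, j} | i j. i \<in> {1..n} \<and> j \<in> {1..n} \<and> i \<noteq> j \<and> between n i j = {}}"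

definition diagonals :: "nat \<Rightarrow> nat set set" where
  "diagonals n = {{i, j} | i j. i \<in> {1..n} \<and> j \<in> {1..n} \<and> i \<noteq> j} - polygon_edges n"

definition crossing :: "nat \<Rightarrow> nat set \<Rightarrow> nat set \<Rightarrow> bool" where
  "crossing n e f \<longleftrightarrow>
     (\<exists>a b x y. e = {a, b} \<and> f = {x, y} \<and> x \<in> between n a b \<and> y \<in> between n b a)"

definition dissection :: "nat \<Rightarrow> nat set set \<Rightarrow> bool" where
  "dissection n T \<longleftrightarrow> T \<subseteq> diagonals n \<and> (\<forall>e\<in>T. \<forall>f\<in>T. \<not> crossing n e f)"

text \<open>The polygons into which the diagonals in \<open>T\<close> cut the \<open>n\<close>-gon: every side is an edge of the
  \<open>n\<close>-gon or belongs to \<open>T\<close>, and no element of \<open>T\<close> cuts the polygon further. Two distinct vertices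
  of \<open>S\<close> span a side of \<open>S\<close> iff \<open>S\<close> has no vertex strictly between them on one of the two arcs.\<close>

definition cells :: "nat \<Rightarrow> nat set set \<Rightarrow> nat set set" where
  "cells n T = {S. S \<subseteq> {1..n} \<and> card S \<ge> 3 \<and>
     (\<forall>a\<in>S. \<forall>b\<in>S. a \<noteq> b \<longrightarrow>
        (if S \<inter> between n a b = {} \<or> S \<inter> between n b a = {}
         then {a, b} \<in> polygon_edges n \<union> T
         else {a, b} \<notin> T))}"

definition d_angulation :: "nat \<Rightarrow> nat \<Rightarrow> nat set set \<Rightarrow> bool" where
  "d_angulation d n T \<longleftrightarrow> dissection n T \<and> (\<forall>\<alpha>\<in>cells n T. card \<alpha> = d)"

text \<open>A \<open>d\<close>-path is a family of cells indexed by the vertices strictly between \<open>i\<close> and \<open>j\<close>.\<close>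

definition d_paths :: "nat \<Rightarrow> nat \<Rightarrow> nat set set \<Rightarrow> nat \<Rightarrow> nat \<Rightarrow> (nat \<Rightarrow> nat set) set" where
  "d_paths d n T i j =
     {p \<in> (\<Pi>\<^sub>E k\<in>between n i j. {\<alpha> \<in> cells n T. k \<in> \<alpha>}).
        \<forall>\<alpha>\<in>cells n T. card {k \<in> between n i j. p k = \<alpha>} \<le> d - 2}"

text \<open>Matrix indices start at \<open>0\<close>, vertex labels at \<open>1\<close>.\<close>

definition path_matrix :: "nat \<Rightarrow> nat \<Rightarrow> nat set set \<Rightarrow> nat mat" where
  "path_matrix d n T = mat n n (\<lambda>(i, j). card (d_paths d n T (Suc i) (Suc j)))"

text \<open>The partial assignments of values to vertices that arise when running the inductive procedure
  based at vertex \<open>i\<close>, choosing cells and pairs of vertices in an arbitrary order. A step fills in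
  only those vertices of the chosen cell that have no value yet and never overwrites one:
  otherwise a cell containing \<open>i\<close>, all of whose values are prescribed initially, would be relabelled.\<close>

inductive labelling :: "nat \<Rightarrow> nat set set \<Rightarrow> nat \<Rightarrow> (nat \<Rightarrow> nat option) \<Rightarrow> bool"
  for n :: nat and T :: "nat set set" and i :: nat where
  start: "labelling n T i
    (\<lambda>v. if v = i then Some 0
         else if \<exists>\<alpha>\<in>cells n T. i \<in> \<alpha> \<and> v \<in> \<alpha> then Some 1 else None)"
| step: "labelling n T i
    (\<lambda>v. if v \<in> \<alpha> \<and> f v = None then Some (x + y) else f v)"
  if "labelling n T i f" and "\<alpha> \<in> cells n T" and "k \<in> \<alpha>" and "l \<in> \<alpha>" and "k \<noteq> l"
    and "f k = Some x" and "f l = Some y"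

text \<open>Using \<open>THE\<close> is justified because the procedure assigns a value to every vertex, and this
  value does not depend on the choices made.\<close>

definition label :: "nat \<Rightarrow> nat set set \<Rightarrow> nat \<Rightarrow> nat \<Rightarrow> nat" where
  "label n T i v = (THE x. \<exists>f. labelling n T i f \<and> f v = Some x)"

definition label_matrix :: "nat \<Rightarrow> nat set set \<Rightarrow> nat mat" where
  "label_matrix n T = mat n n (\<lambda>(i, j). label n T (Suc i) (Suc j))"

end

theory Submission
  imports Defs
begin

text \<open>
  If the diagonal \<open>{k, l}\<close> cuts off a piece with \<open>r\<close> cells, then the piece has \<open>(d - 2) r\<close> vertices strictly
  beyond \<open>{k, l}\<close>, which are incident only to these \<open>r\<close> cells. So a \<open>d\<close>-path through all these vertices
  uses every cell of the piece to its full capacity \<open>d - 2\<close>, its restriction to the piece is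
  unique, and the remaining vertices have to avoid the piece. Now let \<open>\<alpha>\<close> be the cell
  beyond \<open>{k, l}\<close> as seen from \<open>i\<close>, and \<open>v\<close> another vertex of \<open>\<alpha>\<close>. In a \<open>d\<close>-path from \<open>i\<close> to \<open>v\<close>, the
  vertex \<open>k\<close> met first either receives \<open>\<alpha>\<close>, which leaves a \<open>d\<close>-path from \<open>i\<close> to \<open>k\<close>, or it does not, which
  leaves a \<open>d\<close>-path from \<open>i\<close> to \<open>l\<close>. Thus \<open>m(i,v) = m(i,k) + m(i,l)\<close>, and by the mirror image of this
  argument \<open>m(v,i) = m(k,i) + m(l,i)\<close>. Both functions of \<open>v\<close> obey the rules of the labelling
  procedure based at \<open>i\<close>, so both equal its result; this gives the equality and the symmetry at once.
\<close>

subsection \<open>Cyclic order and cells\<close>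

text \<open>The strict ternary cyclic order on labels, independent of \<open>n\<close>. It describes
  \<open>between n a b\<close> only for distinct \<open>a\<close> and \<open>b\<close>:
  \<open>cyc a x a\<close> is false, whereas \<open>between n a a\<close> contains all vertices
  other than the vertex \<open>a\<close>.\<close>

definition cyc :: "nat \<Rightarrow> nat \<Rightarrow> nat \<Rightarrow> bool" where
  "cyc a b c \<longleftrightarrow> a < b \<and> b < c \<or> b < c \<and> c < a \<or> c < a \<and> a < b"

lemma cyc_irrefl [simp]: "\<not> cyc a a b" "\<not> cyc a b b" "\<not> cyc a b a"
  by (auto simp: cyc_def)

lemma cyc_rot: "cyc a b c \<Longrightarrow> cyc b c a"
  by (auto simp: cyc_def)

lemma cyc_trans: "cyc a b c \<Longrightarrow> cyc a c d \<Longrightarrow> cyc a b d"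
  by (auto simp: cyc_def)

lemma cyc_trans': "cyc a b c \<Longrightarrow> cyc a c d \<Longrightarrow> cyc b c d"
  by (auto simp: cyc_def)

lemma cyc_asym: "cyc a b c \<Longrightarrow> \<not> cyc a c b"
  by (auto simp: cyc_def)

lemma cyc_total: "a \<noteq> b \<Longrightarrow> b \<noteq> c \<Longrightarrow> a \<noteq> c \<Longrightarrow> cyc a b c \<or> cyc a c b"
  by (auto simp: cyc_def)

lemma cyc_distinct: "cyc a b c \<Longrightarrow> a \<noteq> b \<and> b \<noteq> c \<and> a \<noteq> c"
  by (auto simp: cyc_def)

text \<open>Read \<open>w\<close> as the successor of \<open>u\<close> in a vertex set containing
  \<open>x\<close>. Coming from the arc before \<open>a\<close>, the step from \<open>u\<close>
  neither stops short of \<open>a\<close> nor jumps over \<open>x\<close>, so it lands between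
  \<open>a\<close> and \<open>b\<close>.\<close>

lemma cyc_jump:
  assumes "cyc a x b" "cyc b u a" "a \<noteq> w" "w \<noteq> u" "\<not> cyc u x w" "\<not> cyc u w a"
  shows "cyc a w b"
proof -
  have ux: "cyc u a x" using cyc_trans[OF cyc_rot[OF assms(1)]] assms(1,2) by (auto simp: cyc_def)
  have uw: "cyc u a w" using cyc_total[of u w a] cyc_distinct[OF ux] assms by auto
  show ?thesis
  proof (cases "w = x")
    case False
    then have "cyc u w x" using cyc_total[of u w x] cyc_distinct[OF ux] assms by auto
    with uw have "cyc a w x" by (rule cyc_trans')
    then show ?thesis using assms(1) by (rule cyc_trans)
  qed (use assms in simp)
qed

lemma between_iff:
  assumes "a \<in> {1..n}" "b \<in> {1..n}" "a \<noteq> b"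
  shows "x \<in> between n a b \<longleftrightarrow> x \<in> {1..n} \<and> cyc a x b"
  using assms by (auto simp: between_def cyc_def)

lemma cyc_imp_between:
  assumes "cyc a x b" "a \<in> {1..n}" "b \<in> {1..n}" "x \<in> {1..n}"
  shows "x \<in> between n a b"
  using assms by (auto simp: between_def cyc_def)

lemma finite_between [simp]: "finite (between n a b)"
  by (auto simp: between_def)

text \<open>Choose the element with the fewest polygon vertices between \<open>x\<close> and itself;
  an element of \<open>S\<close> inside that arc would have a strictly smaller arc. The vertex
  \<open>x\<close> may lie outside \<open>S\<close>, as when a cell is viewed from a vertex not on
  it.\<close>

lemma next_vertex:
  assumes "S \<subseteq> {1..n}" "x \<in> {1..n}" "S - {x} \<noteq> {}"
  obtains y where "y \<in> S" "y \<noteq> x" "S \<inter> between n x y = {}"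
proof -
  obtain y where y: "y \<in> S - {x}" "\<And>z. z \<in> S - {x} \<Longrightarrow> card (between n x y) \<le> card (between n x z)"
    using ex_has_least_nat[of "\<lambda>y. y \<in> S - {x}" _ "\<lambda>y. card (between n x y)"] assms(3) by blast
  have "z \<notin> between n x y" if z: "z \<in> S" for z
  proof
    assume b: "z \<in> between n x y"
    have V: "y \<in> {1..n}" "z \<in> {1..n}" "y \<noteq> x" using y(1) z assms by auto
    have c: "cyc x z y" using b V assms(2) by (simp add: between_iff)
    then have zx: "z \<noteq> x" by auto
    have "between n x z \<subset> between n x y"
    proof
      show "between n x z \<subseteq> between n x y"
        using V c zx assms(2) by (auto simp: between_iff cyc_def)
      show "between n x z \<noteq> between n x y"
        using V c zx assms(2) b by (metis between_iff cyc_irrefl(2))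
    qed
    then have "card (between n x z) < card (between n x y)" by (simp add: psubset_card_mono)
    then show False using y(2)[of z] z zx by auto
  qed
  then show ?thesis using that y(1) by blast
qed

lemma prev_vertex:
  assumes "S \<subseteq> {1..n}" "x \<in> {1..n}" "S - {x} \<noteq> {}"
  obtains y where "y \<in> S" "y \<noteq> x" "S \<inter> between n y x = {}"
proof -
  obtain y where y: "y \<in> S - {x}" "\<And>z. z \<in> S - {x} \<Longrightarrow> card (between n y x) \<le> card (between n z x)"
    using ex_has_least_nat[of "\<lambda>y. y \<in> S - {x}" _ "\<lambda>y. card (between n y x)"] assms(3) by blast
  have "z \<notin> between n y x" if z: "z \<in> S" for z
  proof
    assume b: "z \<in> between n y x"
    have V: "y \<in> {1..n}" "z \<in> {1..n}" "y \<noteq> x" using y(1) z assms by auto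
    have c: "cyc y z x" using b V assms(2) by (simp add: between_iff)
    then have zx: "z \<noteq> x" by auto
    have "between n z x \<subset> between n y x"
    proof
      show "between n z x \<subseteq> between n y x"
        using V c zx assms(2) by (auto simp: between_iff cyc_def)
      show "between n z x \<noteq> between n y x"
        using V c zx assms(2) b by (metis between_iff cyc_irrefl(1))
    qed
    then have "card (between n z x) < card (between n y x)" by (simp add: psubset_card_mono)
    then show False using y(2)[of z] z zx by auto
  qed
  then show ?thesis using that y(1) by blast
qed

section \<open>Sides and chords of cells; no diagonal of \<open>T\<close> crosses a cell\<close>

lemma cellD:
  assumes "S \<in> cells n T"
  shows "S \<subseteq> {1..n}" "card S \<ge> 3" "finite S"
  using assms finite_subset[of S "{1..n}"] by (auto simp: cells_def)

lemma finite_cells [simp]: "finite (cells n T)"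
  by (rule finite_subset[of _ "Pow {1..n}"]) (auto simp: cells_def)

lemma cell_side:
  assumes "S \<in> cells n T" "a \<in> S" "b \<in> S" "a \<noteq> b" "S \<inter> between n a b = {}"
  shows "{a, b} \<in> polygon_edges n \<union> T"
  using assms unfolding cells_def by (auto split: if_splits)

lemma cell_chord:
  assumes "S \<in> cells n T" "a \<in> S" "b \<in> S" "x \<in> S" "x \<in> between n a b" "y \<in> S" "y \<in> between n b a"
    and "a \<noteq> b"
  shows "{a, b} \<notin> T"
proof -
  have "S \<inter> between n a b \<noteq> {}" "S \<inter> between n b a \<noteq> {}" using assms by auto
  then show ?thesis using assms(1-3,8) unfolding cells_def by (simp split: if_splits)
qed

lemma cell_other_vertex:
  assumes "S \<in> cells n T" obtains w where "w \<in> S" "w \<noteq> a" "w \<noteq> b"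
proof -
  have "\<not> S \<subseteq> {a, b}"
    using card_mono[of "{a,b}" S] cellD[OF assms] card_insert_le_m1[of 2 "{b}" a] by fastforce
  then show ?thesis using that by auto
qed

lemma polygon_edge_iff:
  assumes "a \<in> {1..n}" "b \<in> {1..n}" "a \<noteq> b"
  shows "{a, b} \<in> polygon_edges n \<longleftrightarrow> between n a b = {} \<or> between n b a = {}"
  using assms unfolding polygon_edges_def by (fastforce simp: doubleton_eq_iff)

locale polygon_dissection =
  fixes n :: nat and T :: "nat set set"
  assumes dissection: "dissection n T"
begin

lemma no_crossing:
  assumes "{a, b} \<in> T" "{x, y} \<in> T" shows "\<not> (x \<in> between n a b \<and> y \<in> between n b a)"
  using dissection assms unfolding dissection_def crossing_def by blast

lemma diagonal_vertices:
  assumes "{a, b} \<in> T" shows "a \<in> {1..n}" "b \<in> {1..n}" "a \<noteq> b"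
    using dissection assms unfolding dissection_def diagonals_def by (auto simp: doubleton_eq_iff)

text \<open>A side is a polygon edge or an element of \<open>T\<close>. An edge has no vertex on one
  of its arcs, while \<open>a\<close> and \<open>b\<close> lie on different arcs of
  \<open>{x, y}\<close>; and two elements of \<open>T\<close> do not cross.\<close>

lemma side_not_crossing:
  assumes "{a, b} \<in> T" "S \<in> cells n T" "x \<in> S" "y \<in> S" "S \<inter> between n x y = {}"
    "x \<in> between n a b" "y \<in> between n b a"
  shows False
proof -
  note V = diagonal_vertices[OF assms(1)]
  have xy: "x \<in> {1..n}" "y \<in> {1..n}" using assms cellD by blast+
  have c: "cyc a x b" "cyc b y a" using assms V by (auto simp: between_iff)
  have ne: "x \<noteq> y" using c unfolding cyc_def by linarith
  have "{x, y} \<notin> T" using no_crossing assms(1,6,7) by blast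
  then have "{x, y} \<in> polygon_edges n" using cell_side[OF assms(2-4) ne assms(5)] by blast
  then have "between n x y = {} \<or> between n y x = {}" using polygon_edge_iff xy ne by blast
  moreover have "b \<in> between n x y" "a \<in> between n y x"
    using xy ne V c by (auto simp: between_iff cyc_def)
  ultimately show False by blast
qed

lemma side_not_crossing':
  assumes "{a, b} \<in> T" "S \<in> cells n T" "x \<in> S" "y \<in> S" "S \<inter> between n y x = {}"
    "x \<in> between n a b" "y \<in> between n b a"
  shows False
  using side_not_crossing[of b a S y x] assms by (simp add: insert_commute)

text \<open>If a cell had vertices on both sides of \<open>{a, b}\<close>, then either
  \<open>{a, b}\<close> would be one of its chords, which \<open>T\<close> does not contain, or the
  cell would pass over a missing endpoint with a side that crosses \<open>{a, b}\<close>.\<close>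

lemma cell_not_crossing:
  assumes T: "{a, b} \<in> T" and S: "S \<in> cells n T" and x: "x \<in> S" "x \<in> between n a b"
  shows "S \<inter> between n b a = {}"
proof (rule ccontr)
  assume "\<not> ?thesis"
  then obtain y where y: "y \<in> S" "y \<in> between n b a" by blast
  note V = diagonal_vertices[OF T]
  have SV: "S \<subseteq> {1..n}" using cellD[OF S] by simp
  consider "a \<notin> S" | "b \<notin> S" using cell_chord[OF S _ _ x y V(3)] T by blast
  then show False
  proof cases
    case 1
    \<comment> \<open>\<open>u\<close> is the last vertex of \<open>S\<close> on the arc from
      \<open>b\<close> to the missing endpoint \<open>a\<close>, and \<open>w\<close> will be its
      successor in \<open>S\<close>; the side \<open>{u, w}\<close> passes over
      \<open>a\<close>.\<close>
    define U where "U = S \<inter> between n b a"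
    have c: "cyc a x b" "cyc b y a" using x y V by (auto simp: between_iff)
    have "y \<in> U - {a}" "U \<subseteq> {1..n}" using c y SV unfolding U_def by auto
    then obtain u where u: "u \<in> U" "u \<noteq> a" "U \<inter> between n u a = {}"
      using prev_vertex[of U n a] V(1) by (metis empty_iff)
    have uV: "u \<in> {1..n}" "u \<in> S" "cyc b u a" using u SV V by (auto simp: U_def between_iff)
    have "x \<noteq> u" using cyc_asym[OF uV(3)] cyc_rot[OF cyc_rot[OF c(1)]] by blast
    then have "S - {u} \<noteq> {}" using x(1) by blast
    then obtain w where w: "w \<in> S" "w \<noteq> u" "S \<inter> between n u w = {}"
      using next_vertex[OF SV uV(1)] by metis
    have wV: "w \<in> {1..n}" using w SV by auto
    have wa: "w \<noteq> a" using 1 w by auto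
    have "\<not> cyc u x w" using w(3) x(1) wV uV(1) SV cyc_imp_between by blast
    moreover have "\<not> cyc u w a"
    proof
      assume *: "cyc u w a"
      then have "cyc b w a" using uV(3) unfolding cyc_def by linarith
      then show False using * u(3) w(1) wV uV(1) V cyc_imp_between unfolding U_def by blast
    qed
    ultimately have "cyc a w b" using cyc_jump[OF c(1) \<open>cyc b u a\<close>] wa w(2) by metis
    then have "w \<in> between n a b" using V wV by (simp add: between_iff)
    then show False using side_not_crossing'[OF T S w(1) uV(2) w(3)] u(1) by (auto simp: U_def)
  next
    case 2
    define U where "U = S \<inter> between n a b"
    have c: "cyc a x b" "cyc b y a" using x y V by (auto simp: between_iff)
    have "x \<in> U - {b}" "U \<subseteq> {1..n}" using c x SV unfolding U_def by auto
    then obtain u where u: "u \<in> U" "u \<noteq> b" "U \<inter> between n u b = {}"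
      using prev_vertex[of U n b] V(2) by (metis empty_iff)
    have uV: "u \<in> {1..n}" "u \<in> S" "cyc a u b" using u SV V by (auto simp: U_def between_iff)
    have "y \<noteq> u" using cyc_asym[OF uV(3)] cyc_rot[OF cyc_rot[OF c(2)]] by blast
    then have "S - {u} \<noteq> {}" using y(1) by blast
    then obtain w where w: "w \<in> S" "w \<noteq> u" "S \<inter> between n u w = {}"
      using next_vertex[OF SV uV(1)] by metis
    have wV: "w \<in> {1..n}" using w SV by auto
    have wa: "w \<noteq> b" using 2 w by auto
    have "\<not> cyc u y w" using w(3) y(1) wV uV(1) SV cyc_imp_between by blast
    moreover have "\<not> cyc u w b"
    proof
      assume *: "cyc u w b"
      then have "cyc a w b" using uV(3) unfolding cyc_def by linarith
      then show False using * u(3) w(1) wV uV(1) V cyc_imp_between unfolding U_def by blast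
    qed
    ultimately have "cyc b w a" using cyc_jump[OF c(2) \<open>cyc a u b\<close>] wa w(2) by metis
    then have "w \<in> between n b a" using V wV by (simp add: between_iff)
    then show False using side_not_crossing[OF T S uV(2) w(1) w(3)] u(1) by (auto simp: U_def)
  qed
qed

end

section \<open>The cell beyond a side, and induction along arcs\<close>

text \<open>Cutting the circle open at \<open>k\<close> gives a linear order with least element
  \<open>k\<close>, in which arcs become intervals or complements of intervals.\<close>

definition arc_less :: "nat \<Rightarrow> nat \<Rightarrow> nat \<Rightarrow> bool" where
  "arc_less k x y \<longleftrightarrow> x = k \<and> y \<noteq> k \<or> cyc k x y"

lemma arc_less_irrefl [simp]: "\<not> arc_less k x x"
  by (auto simp: arc_less_def)

lemma arc_less_trans: "arc_less k x y \<Longrightarrow> arc_less k y z \<Longrightarrow> arc_less k x z"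
  by (auto simp: arc_less_def cyc_def)

lemma arc_less_total: "arc_less k x y \<or> x = y \<or> arc_less k y x"
  by (auto simp: arc_less_def cyc_def)

lemma arc_less_asym: "arc_less k x y \<Longrightarrow> \<not> arc_less k y x"
  by (auto simp: arc_less_def cyc_def)

lemma arc_less_base [simp]: "\<not> arc_less k x k" "arc_less k k x \<longleftrightarrow> x \<noteq> k"
  by (auto simp: arc_less_def)

lemma cyc_arc_less: "arc_less k a b \<Longrightarrow> cyc a v b \<longleftrightarrow> arc_less k a v \<and> arc_less k v b"
  by (auto simp: arc_less_def cyc_def)

lemma cyc_arc_less': "arc_less k a b \<Longrightarrow> cyc b v a \<longleftrightarrow> arc_less k v a \<or> arc_less k b v"
  by (auto simp: arc_less_def cyc_def)

context polygon_dissection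
begin

text \<open>The cell beyond \<open>{k, l}\<close> consists of the vertices that no other diagonal separates from
  \<open>{k, l}\<close>.\<close>

lemma cell_beyond:
  assumes V: "k \<in> {1..n}" "l \<in> {1..n}" "k \<noteq> l"
    and side: "{k, l} \<in> polygon_edges n \<union> T" and ne: "between n k l \<noteq> {}"
  obtains \<alpha> where "\<alpha> \<in> cells n T" "k \<in> \<alpha>" "l \<in> \<alpha>" "\<alpha> \<inter> between n l k = {}"
proof -
  let ?lt = "arc_less k"
  have kl: "?lt k l" using V by simp
  have bt: "v \<in> between n a b \<longleftrightarrow> v \<in> {1..n} \<and> ?lt a v \<and> ?lt v b"
    if "a \<in> {1..n}" "b \<in> {1..n}" "?lt a b" for a b v
    using between_iff[OF that(1,2)] cyc_arc_less[OF that(3)] that(3) by (cases "a = b") simp_all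
  have bt': "v \<in> between n b a \<longleftrightarrow> v \<in> {1..n} \<and> (?lt v a \<or> ?lt b v)"
    if "a \<in> {1..n}" "b \<in> {1..n}" "?lt a b" for a b v
    using between_iff[OF that(2,1)] cyc_arc_less'[OF that(3)] that(3) by (cases "a = b") simp_all
  \<comment> \<open>\<open>v\<close> is covered if it is cut off from \<open>{k, l}\<close> by a
    diagonal with both ends on the closed arc from \<open>k\<close> to \<open>l\<close>. The lower
    bound on \<open>a\<close> is automatic, as \<open>k\<close> is least.\<close>
  define cov where "cov v \<longleftrightarrow> (\<exists>a b. {a, b} \<in> T \<and> ?lt a v \<and> ?lt v b \<and> (b = l \<or> ?lt b l) \<and> (a, b) \<noteq> (k, l))" for v
  define S where "S = {v \<in> {1..n}. (v = l \<or> ?lt v l) \<and> \<not> cov v}"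
  have SV: "S \<subseteq> {1..n}" by (auto simp: S_def)
  have Sle: "v = l \<or> ?lt v l" if "v \<in> S" for v using that by (simp add: S_def)
  have kS: "k \<in> S" using V by (auto simp: S_def cov_def)
  have lS: "l \<in> S"
    using V by (auto simp: S_def cov_def dest: arc_less_asym)
  \<comment> \<open>If the polygon vertex after \<open>x\<close> is uncovered, it is the successor
    of \<open>x\<close> in \<open>S\<close>; otherwise the successor is the far end of the longest
    admissible diagonal starting at \<open>x\<close>. Excluding \<open>(k, l)\<close> here later
    provides a third vertex of \<open>S\<close>.\<close>
  have nxt: "\<exists>y\<in>S. ?lt x y \<and> S \<inter> between n x y = {} \<and> (between n x y = {} \<or> {x, y} \<in> T \<and> (x, y) \<noteq> (k, l))"
    if x: "x \<in> S" "x \<noteq> l" for x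
  proof -
    have xV: "x \<in> {1..n}" and xl: "?lt x l" using x Sle SV by auto
    have "{1..n} - {x} \<noteq> {}" using V(2) x(2) by blast
    then obtain x' where x': "x' \<in> {1..n}" "x' \<noteq> x" "{1..n} \<inter> between n x x' = {}"
      using next_vertex[of "{1..n}" n x] xV by (metis order_refl)
    have e: "between n x x' = {}" using x'(3) between_iff[OF xV x'(1)] x'(2) by blast
    have xx': "?lt x x'"
    proof (rule ccontr)
      assume "\<not> ?thesis"
      then have "?lt x' x" using arc_less_total x'(2) by metis
      then show False using bt'[OF x'(1) xV, of l] xl e V by auto
    qed
    have x'l: "x' = l \<or> ?lt x' l"
      using bt[OF xV x'(1) xx', of l] e xl V arc_less_total[of k x' l] by blast
    show ?thesis
    proof (cases "x' \<in> S")
      case True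
      then show ?thesis using e xx' by blast
    next
      case False
      then have "cov x'" using x'l x'(1) unfolding S_def by blast
      then obtain a b where ab: "{a, b} \<in> T" "?lt a x'" "?lt x' b" "b = l \<or> ?lt b l" "(a, b) \<noteq> (k, l)"
        unfolding cov_def by blast
      \<comment> \<open>A diagonal covering \<open>x'\<close> has to start at \<open>x\<close>: no
        vertex lies between \<open>x\<close> and \<open>x'\<close>, and a diagonal starting before
        \<open>x\<close> would cover \<open>x\<close> as well.\<close>
      have "\<not> ?lt x a" using bt[OF xV x'(1) xx', of a] e ab(2) diagonal_vertices(1)[OF ab(1)] by blast
      moreover have "\<not> ?lt a x"
        using x(1) ab arc_less_trans[OF xx' ab(3)] unfolding S_def cov_def by blast
      ultimately have ax: "a = x" using arc_less_total by blast
      define B where "B = {b. {x, b} \<in> T \<and> ?lt x b \<and> (b = l \<or> ?lt b l) \<and> (x, b) \<noteq> (k, l)}"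
      have BV: "B \<subseteq> {1..n}" using diagonal_vertices(2) unfolding B_def by blast
      then have fB: "finite B" using finite_subset by blast
      have bB: "b \<in> B" using ab ax arc_less_trans[OF xx' ab(3)] unfolding B_def by blast
      then have "B \<noteq> {}" by blast
      define M where "M = Max ((\<lambda>b. card (between n x b)) ` B)"
      have "M \<in> (\<lambda>b. card (between n x b)) ` B" unfolding M_def using fB bB by (intro Max_in) auto
      then obtain y where y: "y \<in> B" "card (between n x y) = M" by blast
      have ymax: "card (between n x z) \<le> card (between n x y)" if "z \<in> B" for z
        unfolding y(2) M_def using fB that by simp
      have xy: "{x, y} \<in> T" "?lt x y" "y = l \<or> ?lt y l" "(x, y) \<noteq> (k, l)" using y by (auto simp: B_def)
      have yV: "y \<in> {1..n}" using y BV by blast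
      \<comment> \<open>A covering diagonal starting at \<open>x\<close> would be longer than
        \<open>{x, y}\<close>, one starting before \<open>x\<close> would cover \<open>x\<close>,
        and one starting after \<open>x\<close> would cross \<open>{x, y}\<close>.\<close>
      have "\<not> cov y"
      proof
        assume "cov y"
        then obtain p q where pq: "{p, q} \<in> T" "?lt p y" "?lt y q" "q = l \<or> ?lt q l" "(p, q) \<noteq> (k, l)"
          unfolding cov_def by blast
        note pqV = diagonal_vertices[OF pq(1)]
        have xq: "?lt x q" using arc_less_trans[OF xy(2) pq(3)] .
        consider "p = x" | "?lt p x" | "?lt x p" using arc_less_total by blast
        then show False
        proof cases
          case 1
          have qB: "q \<in> B" using pq 1 xq by (simp add: B_def)
          have "between n x y \<subseteq> between n x q"
            using bt[OF xV yV xy(2)] bt[OF xV pqV(2) xq] arc_less_trans[OF _ pq(3)] by blast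
          moreover have "y \<in> between n x q" "y \<notin> between n x y"
            using bt[OF xV yV xy(2)] bt[OF xV pqV(2) xq] xy(2) pq(3) yV by auto
          ultimately have "between n x y \<subset> between n x q" by blast
          then have "card (between n x y) < card (between n x q)" by (simp add: psubset_card_mono)
          then show False using ymax[OF qB] by simp
        next
          case 2
          then show False using x(1) xq pq unfolding S_def cov_def by blast
        next
          case 3
          have "p \<in> between n x y" using bt[OF xV yV xy(2)] 3 pq(2) pqV by blast
          moreover have "q \<in> between n y x" using bt'[OF xV yV xy(2)] pq(3) pqV by blast
          ultimately show False using no_crossing[OF xy(1) pq(1)] by blast
        qed
      qed
      then have yS: "y \<in> S" using yV xy unfolding S_def by blast
      have "S \<inter> between n x y = {}"
        using bt[OF xV yV xy(2)] xy unfolding S_def cov_def by blast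
      then show ?thesis using yS xy by blast
    qed
  qed
  have L1: "{a, b} \<in> polygon_edges n \<union> T" if h: "a \<in> S" "b \<in> S" "?lt a b" "S \<inter> between n a b = {}" for a b
  proof -
    have aV: "a \<in> {1..n}" and bV: "b \<in> {1..n}" using h SV by auto
    have "a \<noteq> l" using h(3) Sle[OF h(2)] by (metis arc_less_asym arc_less_irrefl)
    then obtain y where y: "y \<in> S" "?lt a y" "S \<inter> between n a y = {}" "between n a y = {} \<or> {a, y} \<in> T"
      using nxt[OF h(1)] by metis
    have "y \<in> {1..n}" using y SV by blast
    then have "y = b" using y bt[OF aV bV h(3), of y] bt[OF aV _ y(2), of b] h arc_less_total[of k y b] bV by blast
    moreover have "a \<noteq> b" using h by auto
    ultimately show ?thesis using y(4) polygon_edge_iff[OF aV bV] by blast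
  qed
  \<comment> \<open>Only the pair \<open>{k, l}\<close> has no vertex of \<open>S\<close> on its
    outer arc; it closes the polygon and is admissible by \<open>side\<close>.\<close>
  have L2: "{a, b} \<in> polygon_edges n \<union> T" if h: "a \<in> S" "b \<in> S" "?lt a b" "S \<inter> between n b a = {}" for a b
  proof -
    have aV: "a \<in> {1..n}" and bV: "b \<in> {1..n}" using h SV by auto
    have "a = k" using bt'[OF aV bV h(3), of k] h(4) kS V(1) by (metis IntI arc_less_base(2) empty_iff)
    moreover have "b = l" using bt'[OF aV bV h(3), of l] h(4) lS V(2) Sle[OF h(2)] by blast
    ultimately show ?thesis using side by simp
  qed
  have L3: "{a, b} \<notin> T" if h: "a \<in> S" "b \<in> S" "?lt a b" "S \<inter> between n a b \<noteq> {}" "S \<inter> between n b a \<noteq> {}" for a b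
  proof
    assume ab: "{a, b} \<in> T"
    have aV: "a \<in> {1..n}" and bV: "b \<in> {1..n}" using h SV by auto
    obtain v w where vw: "v \<in> S" "w \<in> S" "v \<in> between n a b" "w \<in> between n b a" using h(4,5) by blast
    \<comment> \<open>Any other element of \<open>T\<close> joining these two vertices would cover
      \<open>v\<close>.\<close>
    have "(a, b) = (k, l)"
      using vw(1,3) ab Sle[OF h(2)] bt[OF aV bV h(3)] unfolding S_def cov_def by blast
    then have "?lt w k \<or> ?lt l w" using vw(4) bt'[OF aV bV h(3), of w] by blast
    then show False using Sle[OF vw(2)] by (metis arc_less_asym arc_less_base(1) arc_less_irrefl)
  qed
  \<comment> \<open>The arc from \<open>k\<close> to \<open>l\<close> is nonempty, so the successor
    of \<open>k\<close> differs from \<open>l\<close> and is a third vertex.\<close>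
  obtain y where y: "y \<in> S" "?lt k y" "between n k y = {} \<or> (k, y) \<noteq> (k, l)"
    using nxt[OF kS V(3)] by metis
  have "y \<noteq> l" "y \<noteq> k" using y ne by auto
  then have "card {k, l, y} = 3" using V(3) by simp
  moreover have "card {k, l, y} \<le> card S"
    using SV finite_subset[OF SV] kS lS y(1) by (intro card_mono) auto
  ultimately have c: "card S \<ge> 3" by simp
  have "S \<in> cells n T"
    unfolding cells_def mem_Collect_eq
  proof (intro conjI ballI impI SV c)
    fix a b assume ab: "a \<in> S" "b \<in> S" "a \<noteq> b"
    show "if S \<inter> between n a b = {} \<or> S \<inter> between n b a = {} then {a, b} \<in> polygon_edges n \<union> T else {a, b} \<notin> T"
    proof (cases "?lt a b")
      case True
      then show ?thesis using L1[OF ab(1,2)] L2[OF ab(1,2)] L3[OF ab(1,2)] by auto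
    next
      case False
      then have "?lt b a" using ab(3) arc_less_total by blast
      then show ?thesis using L1[OF ab(2,1)] L2[OF ab(2,1)] L3[OF ab(2,1)] by (auto simp: insert_commute)
    qed
  qed
  moreover have "S \<inter> between n l k = {}"
    using bt'[OF V(1,2) kl] Sle by (metis arc_less_asym arc_less_base(1) arc_less_irrefl disjoint_iff)
  ultimately show ?thesis using that kS lS by blast
qed

text \<open>Strong induction on the number of vertices strictly between \<open>k\<close> and
  \<open>l\<close>. It unfolds the tree of cells on one side of a chord: cut the arc at a vertex of
  \<alpha>, or, along a side of \<alpha>, pass over the diagonal to the next cell.\<close>

lemma arc_induct [consumes 4, case_names empty split beyond]:
  assumes "\<alpha> \<in> cells n T" "k \<in> \<alpha>" "l \<in> \<alpha>" "k \<noteq> l"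
    and empty: "\<And>\<alpha> k l. \<alpha> \<in> cells n T \<Longrightarrow> k \<in> \<alpha> \<Longrightarrow> l \<in> \<alpha> \<Longrightarrow> k \<noteq> l \<Longrightarrow> between n k l = {} \<Longrightarrow> P \<alpha> k l"
    and split: "\<And>\<alpha> k l v. \<alpha> \<in> cells n T \<Longrightarrow> k \<in> \<alpha> \<Longrightarrow> l \<in> \<alpha> \<Longrightarrow> k \<noteq> l \<Longrightarrow> v \<in> \<alpha> \<Longrightarrow> v \<in> between n k l \<Longrightarrow>
      P \<alpha> k v \<Longrightarrow> P \<alpha> v l \<Longrightarrow> P \<alpha> k l"
    and beyond: "\<And>\<alpha> \<beta> k l. \<alpha> \<in> cells n T \<Longrightarrow> k \<in> \<alpha> \<Longrightarrow> l \<in> \<alpha> \<Longrightarrow> k \<noteq> l \<Longrightarrow> {k, l} \<in> T \<Longrightarrow>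
      \<alpha> \<inter> between n k l = {} \<Longrightarrow> \<beta> \<in> cells n T \<Longrightarrow> k \<in> \<beta> \<Longrightarrow> l \<in> \<beta> \<Longrightarrow> \<beta> \<inter> between n l k = {} \<Longrightarrow>
      P \<beta> k l \<Longrightarrow> P \<alpha> k l"
  shows "P \<alpha> k l"
proof -
  have "\<forall>\<alpha> k l. card (between n k l) = m \<longrightarrow> \<alpha> \<in> cells n T \<longrightarrow> k \<in> \<alpha> \<longrightarrow> l \<in> \<alpha> \<longrightarrow> k \<noteq> l \<longrightarrow> P \<alpha> k l" for m
  proof (induction m rule: less_induct)
    case (less m)
    \<comment> \<open>Stated for arcs of the current size, because passing to the cell beyond a
      diagonal does not shorten the arc. That cell has a vertex inside the arc, so this fact applies
      to it and leads to shorter arcs.\<close>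
    have split': "P \<alpha> k l" if m: "card (between n k l) = m" and a: "\<alpha> \<in> cells n T" "k \<in> \<alpha>" "l \<in> \<alpha>" "k \<noteq> l"
      "v \<in> \<alpha>" "v \<in> between n k l" for \<alpha> k l v
    proof -
      have V: "k \<in> {1..n}" "l \<in> {1..n}" "v \<in> {1..n}" using a cellD(1) by blast+
      have c: "cyc k v l" using a V by (simp add: between_iff)
      have ne: "k \<noteq> v" "v \<noteq> l" using cyc_distinct[OF c] by auto
      have "between n k v \<subseteq> between n k l" "between n v l \<subseteq> between n k l"
        using V c ne a(4) cyc_trans[OF _ c] cyc_trans[OF cyc_rot[OF c]]
        by (auto simp: between_iff intro: cyc_rot) (metis cyc_rot cyc_trans)
      moreover have "v \<notin> between n k v" "v \<notin> between n v l" using V ne by (auto simp: between_iff)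
      ultimately have "between n k v \<subset> between n k l" "between n v l \<subset> between n k l" using a(6) by blast+
      then have "card (between n k v) < m" "card (between n v l) < m" unfolding m[symmetric]
        by (simp_all add: psubset_card_mono)
      then have "P \<alpha> k v" "P \<alpha> v l" using less a ne by blast+
      then show ?thesis using split a by blast
    qed
    show ?case
    proof (intro allI impI)
      fix \<alpha> k l assume m: "card (between n k l) = m" and a: "\<alpha> \<in> cells n T" "k \<in> \<alpha>" "l \<in> \<alpha>" "k \<noteq> l"
      have V: "k \<in> {1..n}" "l \<in> {1..n}" using a cellD(1) by blast+
      consider "between n k l = {}" | v where "v \<in> \<alpha>" "v \<in> between n k l"
        | "between n k l \<noteq> {}" "\<alpha> \<inter> between n k l = {}" by blast
      then show "P \<alpha> k l"
      proof cases
        case 1 then show ?thesis using empty a by blast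
      next
        case 2 then show ?thesis using split' m a by blast
      next
        case 3
        have side: "{k, l} \<in> polygon_edges n \<union> T" using cell_side a 3 by blast
        obtain w where w: "w \<in> \<alpha>" "w \<noteq> k" "w \<noteq> l" using cell_other_vertex[OF a(1)] by metis
        have wV: "w \<in> {1..n}" using w a cellD(1) by blast
        have "w \<in> between n l k"
          using 3(2) w wV V a(4) cyc_total[of k w l] cyc_imp_between[of k w l] cyc_imp_between[of l w k] cyc_rot by blast
        then have "{k, l} \<notin> polygon_edges n" using polygon_edge_iff V a(4) 3(1) by blast
        then have T: "{k, l} \<in> T" using side by blast
        obtain \<beta> where b: "\<beta> \<in> cells n T" "k \<in> \<beta>" "l \<in> \<beta>" "\<beta> \<inter> between n l k = {}"
          using cell_beyond[OF V a(4) side 3(1)] .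
        obtain v where v: "v \<in> \<beta>" "v \<noteq> k" "v \<noteq> l" using cell_other_vertex[OF b(1)] by metis
        have vV: "v \<in> {1..n}" using v b cellD(1) by blast
        have "v \<in> between n k l"
          using b(4) v vV V a(4) cyc_total[of k v l] cyc_imp_between[of k v l] cyc_imp_between[of l v k] cyc_rot by blast
        then have "P \<beta> k l" using split' m b v a by blast
        then show ?thesis using beyond[OF a T 3(2) b] by blast
      qed
    qed
  qed
  then show ?thesis using assms(1-4) by blast
qed

end

subsection \<open>Assignments of cells to vertices\<close>

definition inc :: "'a set set \<Rightarrow> 'a set \<Rightarrow> 'a set set" where
  "inc C X = {\<alpha> \<in> C. \<alpha> \<inter> X \<noteq> {}}"

definition assignments :: "nat \<Rightarrow> 'a set set \<Rightarrow> 'a set \<Rightarrow> ('a \<Rightarrow> 'a set) set" where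
  "assignments c C B =
     {p \<in> (\<Pi>\<^sub>E k\<in>B. {\<alpha> \<in> C. k \<in> \<alpha>}). \<forall>\<alpha>. card {k \<in> B. p k = \<alpha>} \<le> c}"

text \<open>By the equality of cardinalities an assignment on a tight set exhausts every cell it meets.\<close>

definition tight :: "nat \<Rightarrow> 'a set set \<Rightarrow> 'a set \<Rightarrow> bool" where
  "tight c C I \<longleftrightarrow> finite I \<and> card I = c * card (inc C I) \<and> card (assignments c C I) = 1"

lemma assignmentsI:
  assumes "\<And>k. k \<in> B \<Longrightarrow> p k \<in> C" "\<And>k. k \<in> B \<Longrightarrow> k \<in> p k" "\<And>k. k \<notin> B \<Longrightarrow> p k = undefined"
    "\<And>\<alpha>. card {k \<in> B. p k = \<alpha>} \<le> c"
  shows "p \<in> assignments c C B"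
  using assms by (auto simp: assignments_def PiE_def extensional_def)

lemma assignmentsD:
  assumes "p \<in> assignments c C B"
  shows "k \<in> B \<Longrightarrow> p k \<in> C" "k \<in> B \<Longrightarrow> k \<in> p k" "k \<notin> B \<Longrightarrow> p k = undefined"
    "card {k \<in> B. p k = \<alpha>} \<le> c"
  using assms by (auto simp: assignments_def PiE_def extensional_def)

lemma d_paths_eq_assignments: "d_paths d n T i j = assignments (d - 2) (cells n T) (between n i j)"
proof -
  have "card {k \<in> between n i j. p k = \<alpha>} \<le> d - 2"
    if "p \<in> (\<Pi>\<^sub>E k\<in>between n i j. {\<alpha> \<in> cells n T. k \<in> \<alpha>})"
      "\<forall>\<alpha>\<in>cells n T. card {k \<in> between n i j. p k = \<alpha>} \<le> d - 2" for p \<alpha>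
  proof (cases "\<alpha> \<in> cells n T")
    case False
    then have "{k \<in> between n i j. p k = \<alpha>} = {}" using that(1) by (auto simp: PiE_def Pi_def)
    then show ?thesis by (simp only: card.empty le0)
  qed (use that in blast)
  then show ?thesis unfolding d_paths_def assignments_def by blast
qed

lemma assignments_empty [simp]: "assignments c C {} = {\<lambda>_. undefined}"
  by (auto simp: assignments_def)

lemma assignments_cong:
  assumes "\<And>k \<alpha>. k \<in> B \<Longrightarrow> k \<in> \<alpha> \<Longrightarrow> \<alpha> \<in> C \<longleftrightarrow> \<alpha> \<in> C'"
  shows "assignments c C B = assignments c C' B"
proof -
  have "{\<alpha> \<in> C. k \<in> \<alpha>} = {\<alpha> \<in> C'. k \<in> \<alpha>}" if "k \<in> B" for k using assms that by blast
  then show ?thesis unfolding assignments_def by (simp cong: PiE_cong)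
qed

lemma inc_Un: "inc C (X \<union> Y) = inc C X \<union> inc C Y"
  by (auto simp: inc_def)

section \<open>Counting assignments by decomposing the vertex set\<close>

lemma card_split_use:
  assumes "finite I" "finite X" "I \<inter> X = {}"
  shows "card {k \<in> I \<union> X. p k = \<alpha>} = card {k \<in> I. p k = \<alpha>} + card {k \<in> X. p k = \<alpha>}"
proof -
  have "{k \<in> I \<union> X. p k = \<alpha>} = {k \<in> I. p k = \<alpha>} \<union> {k \<in> X. p k = \<alpha>}" by blast
  then show ?thesis using assms by (simp add: card_Un_disjoint disjoint_iff)
qed

lemma card_if_use:
  "{k \<in> I. (if k \<in> I then p k else q k) = \<alpha>} = {k \<in> I. p k = \<alpha>}"
  "I \<inter> X = {} \<Longrightarrow> {k \<in> X. (if k \<in> I then p k else q k) = \<alpha>} = {k \<in> X. q k = \<alpha>}"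
  "{k \<in> I. restrict p I k = \<alpha>} = {k \<in> I. p k = \<alpha>}"
  by auto

text \<open>The cells meeting \<open>I\<close> have total capacity exactly \<open>card I\<close>, so
  \<open>I\<close> uses them up. An assignment is therefore a pair: the unique one on
  \<open>I\<close>, and one on \<open>X\<close> from the remaining cells.\<close>

lemma card_assignments_tight:
  assumes "finite C" "finite X" "I \<inter> X = {}" and tight: "tight c C I"
  shows "card (assignments c C (I \<union> X)) = card (assignments c (C - inc C I) X)"
proof -
  have fI: "finite I" and cI: "card I = c * card (inc C I)" using tight by (auto simp: tight_def)
  have finc: "finite (inc C I)" using assms(1) by (simp add: inc_def)
  let ?f = "\<lambda>p. (restrict p I, restrict p X)"
  let ?g = "\<lambda>(p, q). \<lambda>x. if x \<in> I then p x else q x"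
  \<comment> \<open>If some vertex of \<open>X\<close> used a cell meeting \<open>I\<close>, that
    cell would receive fewer than \<open>c\<close> vertices of \<open>I\<close>, and counting
    \<open>I\<close> cell by cell would fall short of \<open>card I\<close>.\<close>
  have full: "p k \<notin> inc C I" if p: "p \<in> assignments c C (I \<union> X)" and k: "k \<in> X" for p k
  proof
    assume pk: "p k \<in> inc C I"
    have le: "card {x \<in> I. p x = \<beta>} \<le> c" for \<beta>
      using assignmentsD(4)[OF p, of \<beta>] card_split_use[OF fI assms(2,3), of p \<beta>] by linarith
    have "{x \<in> X. p x = p k} \<noteq> {}" using k by blast
    then have "card {x \<in> X. p x = p k} > 0" using assms(2) by (simp add: card_gt_0_iff)
    then have less: "card {x \<in> I. p x = p k} < c"
      using assignmentsD(4)[OF p, of "p k"] card_split_use[OF fI assms(2,3), of p "p k"] by linarith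
    have "p ` I \<subseteq> inc C I" using assignmentsD(1,2)[OF p] unfolding inc_def by blast
    then have "card I = (\<Sum>\<beta>\<in>inc C I. card {x \<in> I. p x = \<beta>})"
      using sum.group[OF fI finc, of p "\<lambda>_. 1::nat"] by simp
    also have "\<dots> < (\<Sum>\<beta>\<in>inc C I. c)"
      using finc pk le less by (intro sum_strict_mono_ex1) auto
    finally show False using cI by (simp add: mult.commute)
  qed
  have "bij_betw ?f (assignments c C (I \<union> X)) (assignments c C I \<times> assignments c (C - inc C I) X)"
  proof (rule bij_betw_byWitness[where f' = ?g])
    show "\<forall>p\<in>assignments c C (I \<union> X). ?g (?f p) = p"
    proof
      fix p assume p: "p \<in> assignments c C (I \<union> X)"
      show "?g (?f p) = p"
        using assignmentsD(3)[OF p] by (auto simp: fun_eq_iff restrict_def)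
    qed
    show "\<forall>pq\<in>assignments c C I \<times> assignments c (C - inc C I) X. ?f (?g pq) = pq"
    proof (clarify, intro conjI ext)
      fix p q x assume p: "p \<in> assignments c C I" and q: "q \<in> assignments c (C - inc C I) X"
      show "restrict (\<lambda>x. if x \<in> I then p x else q x) I x = p x"
        using assignmentsD(3)[OF p] by (auto simp: restrict_def)
      show "restrict (\<lambda>x. if x \<in> I then p x else q x) X x = q x"
        using assignmentsD(3)[OF q] assms(3) by (auto simp: restrict_def)
    qed
    show "?f ` assignments c C (I \<union> X) \<subseteq> assignments c C I \<times> assignments c (C - inc C I) X"
    proof (clarify, intro conjI)
      fix p assume p: "p \<in> assignments c C (I \<union> X)"
      have le: "card {x \<in> I. p x = \<beta>} \<le> c" "card {x \<in> X. p x = \<beta>} \<le> c" for \<beta>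
        using assignmentsD(4)[OF p, of \<beta>] card_split_use[OF fI assms(2,3), of p \<beta>] by linarith+
      show "restrict p I \<in> assignments c C I"
        by (rule assignmentsI) (use assignmentsD[OF p] le in \<open>auto simp: card_if_use\<close>)
      show "restrict p X \<in> assignments c (C - inc C I) X"
        by (rule assignmentsI) (use assignmentsD[OF p] le full[OF p] in \<open>auto simp: card_if_use\<close>)
    qed
    show "?g ` (assignments c C I \<times> assignments c (C - inc C I) X) \<subseteq> assignments c C (I \<union> X)"
    proof (clarify)
      fix p q assume p: "p \<in> assignments c C I" and q: "q \<in> assignments c (C - inc C I) X"
      show "(\<lambda>x. if x \<in> I then p x else q x) \<in> assignments c C (I \<union> X)"
      proof (rule assignmentsI)
        fix \<beta>
        \<comment> \<open>The two parts use disjoint families of cells, so their loads on one cell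
          never add up.\<close>
        have "card {k \<in> I. p k = \<beta>} = 0 \<or> card {k \<in> X. q k = \<beta>} = 0"
        proof (cases "\<beta> \<in> inc C I")
          case True
          then have "{k \<in> X. q k = \<beta>} = {}" using assignmentsD(1)[OF q] by blast
          then show ?thesis by (simp only: card.empty simp_thms)
        next
          case False
          then have "{k \<in> I. p k = \<beta>} = {}" using assignmentsD(1,2)[OF p] unfolding inc_def by blast
          then show ?thesis by (simp only: card.empty simp_thms)
        qed
        then show "card {k \<in> I \<union> X. (if k \<in> I then p k else q k) = \<beta>} \<le> c"
          unfolding card_split_use[OF fI assms(2,3)] card_if_use(1) card_if_use(2)[OF assms(3)]
          using assignmentsD(4)[OF p, of \<beta>] assignmentsD(4)[OF q, of \<beta>] by linarith
      qed (use assignmentsD[OF p] assignmentsD[OF q] in auto)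
    qed
  qed
  then have "card (assignments c C (I \<union> X)) = card (assignments c C I \<times> assignments c (C - inc C I) X)"
    by (rule bij_betw_same_card)
  then show ?thesis using tight by (simp add: card_cartesian_product tight_def)
qed

text \<open>The vertices of \<open>Y\<close> have no choice but \<alpha>, and by the bound there is
  room for them even if every vertex of \<open>X\<close> on \<alpha> also chooses \<alpha>.
  Restriction to \<open>X\<close> is thus a bijection.\<close>

lemma card_assignments_forced:
  assumes fin: "finite X" "finite Y" "Y \<inter> X = {}" and \<alpha>: "\<alpha> \<in> C"
    and Y: "Y \<subseteq> \<alpha>" "\<And>w \<beta>. w \<in> Y \<Longrightarrow> \<beta> \<in> C \<Longrightarrow> w \<in> \<beta> \<Longrightarrow> \<beta> = \<alpha>"
    and c: "card Y + card (X \<inter> \<alpha>) \<le> c"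
  shows "card (assignments c C (Y \<union> X)) = card (assignments c C X)"
proof -
  let ?f = "\<lambda>p. restrict p X"
  let ?g = "\<lambda>p x. if x \<in> Y then \<alpha> else p x"
  have pY: "p w = \<alpha>" if "p \<in> assignments c C (Y \<union> X)" "w \<in> Y" for p w
    using assignmentsD(1,2)[OF that(1) UnI1[OF that(2)]] Y(2)[OF that(2)] by blast
  have "bij_betw ?f (assignments c C (Y \<union> X)) (assignments c C X)"
  proof (rule bij_betw_byWitness[where f' = ?g])
    show "\<forall>p\<in>assignments c C (Y \<union> X). ?g (?f p) = p"
    proof
      fix p assume p: "p \<in> assignments c C (Y \<union> X)"
      show "?g (?f p) = p"
        using assignmentsD(3)[OF p] pY[OF p] by (auto simp: fun_eq_iff restrict_def)
    qed
    show "\<forall>p\<in>assignments c C X. ?f (?g p) = p"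
    proof
      fix p assume p: "p \<in> assignments c C X"
      show "?f (?g p) = p" using assignmentsD(3)[OF p] fin(3) by (auto simp: fun_eq_iff restrict_def)
    qed
    show "?f ` assignments c C (Y \<union> X) \<subseteq> assignments c C X"
    proof clarify
      fix p assume p: "p \<in> assignments c C (Y \<union> X)"
      have le: "card {x \<in> X. p x = \<beta>} \<le> c" for \<beta>
        using assignmentsD(4)[OF p, of \<beta>] card_split_use[OF fin(2,1,3), of p \<beta>] by linarith
      show "restrict p X \<in> assignments c C X"
        by (rule assignmentsI) (use assignmentsD[OF p] le in \<open>auto simp: card_if_use\<close>)
    qed
    show "?g ` assignments c C X \<subseteq> assignments c C (Y \<union> X)"
    proof clarify
      fix p assume p: "p \<in> assignments c C X"
      show "?g p \<in> assignments c C (Y \<union> X)"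
      proof (rule assignmentsI)
        fix \<beta>
        have u: "card {k \<in> Y. \<alpha> = \<beta>} + card {k \<in> X. p k = \<beta>} \<le> c"
        proof (cases "\<beta> = \<alpha>")
          case True
          have "card {k \<in> X. p k = \<beta>} \<le> card (X \<inter> \<alpha>)"
            using assignmentsD(2)[OF p] True fin(1) by (intro card_mono) auto
          then show ?thesis using True c by simp
        next
          case False
          then show ?thesis using assignmentsD(4)[OF p, of \<beta>] by simp
        qed
        show "card {k \<in> Y \<union> X. (if k \<in> Y then \<alpha> else p k) = \<beta>} \<le> c"
          using u unfolding card_split_use[OF fin(2,1,3)] card_if_use(1) card_if_use(2)[OF fin(3)] .
      qed (use assignmentsD[OF p] \<alpha> Y(1) in auto)
    qed
  qed
  then show ?thesis by (rule bij_betw_same_card)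
qed

lemma card_assignments_insert:
  assumes fin: "finite A" "finite C" "k \<notin> A" and \<alpha>: "\<alpha> \<in> C" "k \<in> \<alpha>" "A \<inter> \<alpha> = {}" and c: "c \<ge> 1"
  shows "card (assignments c C (insert k A)) = card (assignments c C A) + card (assignments c (C - {\<alpha>}) (insert k A))"
proof -
  have "finite (\<Pi>\<^sub>E x\<in>insert k A. {\<alpha> \<in> C. x \<in> \<alpha>})" using fin by (intro finite_PiE) auto
  then have finite: "finite (assignments c C (insert k A))"
    unfolding assignments_def by (rule finite_subset[rotated]) blast
  have not: "p x \<noteq> \<alpha>" if "p \<in> assignments c C B" "x \<in> B" "x \<in> A" for p x B
    using assignmentsD(2)[OF that(1,2)] that(3) \<alpha>(3) by auto
  let ?P = "{p \<in> assignments c C (insert k A). p k = \<alpha>}"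
  have eq: "assignments c (C - {\<alpha>}) (insert k A) = {p \<in> assignments c C (insert k A). p k \<noteq> \<alpha>}"
    (is "?L = ?R")
  proof
    show "?L \<subseteq> ?R" by (auto simp: assignments_def PiE_def)
    show "?R \<subseteq> ?L"
    proof clarify
      fix p assume p: "p \<in> assignments c C (insert k A)" and pk: "p k \<noteq> \<alpha>"
      show "p \<in> assignments c (C - {\<alpha>}) (insert k A)"
      proof (rule assignmentsI)
        show "p x \<in> C - {\<alpha>}" if "x \<in> insert k A" for x
          using assignmentsD(1)[OF p that] not[OF p that] pk that by blast
      qed (fact assignmentsD[OF p])+
    qed
  qed
  have use: "card {x \<in> insert k A. p x = \<beta>} = card {x \<in> {k}. p x = \<beta>} + card {x \<in> A. p x = \<beta>}" for p :: "'a \<Rightarrow> 'a set" and \<beta>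
    using card_split_use[of "{k}" A p \<beta>] fin by simp
  have "bij_betw (\<lambda>p. restrict p A) ?P (assignments c C A)"
  proof (rule bij_betw_byWitness[where f' = "\<lambda>p. p(k := \<alpha>)"])
    show "\<forall>p\<in>?P. (restrict p A)(k := \<alpha>) = p"
      by (auto simp: fun_eq_iff restrict_def dest: assignmentsD(3))
    show "\<forall>p\<in>assignments c C A. restrict (p(k := \<alpha>)) A = p"
      using fin(3) by (auto simp: fun_eq_iff restrict_def dest: assignmentsD(3))
    show "(\<lambda>p. restrict p A) ` ?P \<subseteq> assignments c C A"
    proof clarify
      fix p assume p: "p \<in> assignments c C (insert k A)"
      have le: "card {x \<in> A. p x = \<beta>} \<le> c" for \<beta>
        using assignmentsD(4)[OF p, of \<beta>] use[of p \<beta>] by linarith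
      show "restrict p A \<in> assignments c C A"
        by (rule assignmentsI) (use assignmentsD[OF p] le in \<open>auto simp: card_if_use\<close>)
    qed
    show "(\<lambda>p. p(k := \<alpha>)) ` assignments c C A \<subseteq> ?P"
    proof clarify
      fix p assume p: "p \<in> assignments c C A"
      have "p(k := \<alpha>) \<in> assignments c C (insert k A)"
      proof (rule assignmentsI)
        fix \<beta>
        have e: "{x \<in> A. (p(k := \<alpha>)) x = \<beta>} = {x \<in> A. p x = \<beta>}" using fin(3) by auto
        have "card {x \<in> {k}. (p(k := \<alpha>)) x = \<beta>} + card {x \<in> A. p x = \<beta>} \<le> c"
        proof (cases "\<beta> = \<alpha>")
          case True
          then have "{x \<in> A. p x = \<beta>} = {}" using not[OF p] by blast
          moreover have "card {x \<in> {k}. (p(k := \<alpha>)) x = \<beta>} \<le> card {k}" by (intro card_mono) auto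
          ultimately show ?thesis using c by (simp only: card.empty) simp
        next
          case False
          then have "{x \<in> {k}. (p(k := \<alpha>)) x = \<beta>} = {}" by auto
          then show ?thesis using assignmentsD(4)[OF p, of \<beta>] by (simp only: card.empty)
        qed
        then show "card {x \<in> insert k A. (p(k := \<alpha>)) x = \<beta>} \<le> c" unfolding use e .
      qed (use assignmentsD[OF p] \<alpha> fin(3) in auto)
      then show "p(k := \<alpha>) \<in> assignments c C (insert k A) \<and> (p(k := \<alpha>)) k = \<alpha>" by simp
    qed
  qed
  then have "card ?P = card (assignments c C A)" by (rule bij_betw_same_card)
  moreover have "assignments c C (insert k A) = ?P \<union> {p \<in> assignments c C (insert k A). p k \<noteq> \<alpha>}"
    by blast
  then have "card (assignments c C (insert k A)) = card ?P + card {p \<in> assignments c C (insert k A). p k \<noteq> \<alpha>}"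
    using finite by (subst card_Un_disjoint[symmetric]) auto
  ultimately show ?thesis unfolding eq by simp
qed

text \<open>As no cell meets both sets, deleting the cells at \<open>I\<close> does not affect the
  choices on \<open>J\<close>, and both cardinalities add.\<close>

lemma tight_Un:
  assumes "finite C" "tight c C I" "tight c C J" "I \<inter> J = {}" "inc C I \<inter> inc C J = {}"
  shows "tight c C (I \<union> J)"
proof -
  have "inc C (I \<union> J) = inc C I \<union> inc C J" by (rule inc_Un)
  moreover have "finite (inc C I)" "finite (inc C J)" using assms(1) by (auto simp: inc_def)
  ultimately have "card (inc C (I \<union> J)) = card (inc C I) + card (inc C J)"
    using assms(5) by (simp add: card_Un_disjoint)
  moreover have "card (I \<union> J) = card I + card J" using assms by (simp add: tight_def card_Un_disjoint)
  moreover have "assignments c (C - inc C I) J = assignments c C J"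
    using assms(5) by (intro assignments_cong) (auto simp: inc_def)
  then have "card (assignments c C (I \<union> J)) = card (assignments c C J)"
    using card_assignments_tight[OF assms(1) _ assms(4,2)] assms(3) by (simp add: tight_def)
  ultimately show ?thesis using assms(2,3) by (simp add: tight_def algebra_simps)
qed

text \<open>Once the cells at \<open>I\<close> are exhausted, the \<open>c\<close> vertices of
  \<open>Y\<close> can only use \<alpha>, and they fill it exactly: one more cell, \<open>c\<close>
  more vertices, still one assignment.\<close>

lemma tight_fill:
  assumes C: "finite C" "tight c C I" "finite Y" "I \<inter> Y = {}" and \<alpha>: "\<alpha> \<in> C" "\<alpha> \<notin> inc C I"
    and Y: "Y \<subseteq> \<alpha>" "Y \<noteq> {}" "\<And>w \<beta>. w \<in> Y \<Longrightarrow> \<beta> \<in> C \<Longrightarrow> w \<in> \<beta> \<Longrightarrow> \<beta> \<in> insert \<alpha> (inc C I)"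
    and c: "card Y = c"
  shows "tight c C (I \<union> Y)" "inc C (I \<union> Y) = insert \<alpha> (inc C I)"
proof -
  show inc: "inc C (I \<union> Y) = insert \<alpha> (inc C I)"
  proof (intro equalityI subsetI)
    fix \<beta> assume "\<beta> \<in> inc C (I \<union> Y)"
    then consider "\<beta> \<in> inc C I" | w where "\<beta> \<in> C" "w \<in> Y" "w \<in> \<beta>" unfolding inc_def by blast
    then show "\<beta> \<in> insert \<alpha> (inc C I)" using Y(3) by cases blast+
  next
    fix \<beta> assume "\<beta> \<in> insert \<alpha> (inc C I)"
    moreover have "\<alpha> \<inter> Y \<noteq> {}" using Y(1,2) by blast
    ultimately show "\<beta> \<in> inc C (I \<union> Y)" using \<alpha>(1) unfolding inc_def by blast
  qed
  have "finite (inc C I)" using C(1) by (auto simp: inc_def)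
  then have "card (inc C (I \<union> Y)) = Suc (card (inc C I))" unfolding inc using \<alpha>(2) by simp
  moreover have "card (I \<union> Y) = card I + c" using C c by (simp add: tight_def card_Un_disjoint)
  moreover have "card (assignments c (C - inc C I) (Y \<union> {})) = card (assignments c (C - inc C I) {})"
    using C(3) \<alpha> Y c by (intro card_assignments_forced[where \<alpha> = \<alpha>]) auto
  then have "card (assignments c C (I \<union> Y)) = 1"
    using card_assignments_tight[OF C(1,3,4,2)] by simp
  ultimately show "tight c C (I \<union> Y)" using C by (simp add: tight_def)
qed

text \<open>Either \<open>k\<close> is assigned \<open>\<alpha>\<close>, and the rest of the assignment is one on \<open>A\<close>; or \<open>k\<close> avoids all cells
  meeting \<open>L\<close>, and the assignment on \<open>A\<close> and \<open>k\<close> extends uniquely to \<open>L\<close>.\<close>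

lemma card_assignments_recursion:
  assumes fin: "finite C" "finite A" "finite L"
    and \<alpha>: "\<alpha> \<in> C" "k \<in> \<alpha>" "A \<inter> \<alpha> = {}"
    and J: "J \<subseteq> L" "k \<notin> A" "k \<notin> L" "A \<inter> L = {}"
    and tight: "tight c C (J - \<alpha>)" "tight c C L" "\<alpha> \<in> inc C L"
    and far: "\<And>\<beta>. \<beta> \<in> inc C L \<Longrightarrow> A \<inter> \<beta> = {}"
    and at_k: "\<And>\<beta>. \<beta> \<in> inc C L \<Longrightarrow> k \<in> \<beta> \<Longrightarrow> \<beta> \<in> insert \<alpha> (inc C (J - \<alpha>))"
    and forced: "\<And>w \<beta>. w \<in> J \<inter> \<alpha> \<Longrightarrow> \<beta> \<in> C \<Longrightarrow> w \<in> \<beta> \<Longrightarrow> \<beta> \<in> insert \<alpha> (inc C (J - \<alpha>))"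
    and \<alpha>J: "\<alpha> \<notin> inc C (J - \<alpha>)" and c: "card (J \<inter> \<alpha>) < c"
  shows "card (assignments c C (insert k A \<union> J)) =
    card (assignments c C A) + card (assignments c C (insert k A \<union> L))"
proof -
  \<comment> \<open>In the application, \<open>A\<close>, \<open>J\<close> and \<open>L\<close> are
    the vertices strictly between \<open>i\<close> and \<open>k\<close>, between \<open>k\<close>
    and \<open>v\<close>, and between \<open>k\<close> and \<open>l\<close>. First \<open>J\<close>
    is removed: the part off \<alpha> is tight, the part on \<alpha> is forced into \<alpha> and
    leaves room for \<open>k\<close>.\<close>
  let ?C = "C - inc C (J - \<alpha>)"
  have fJ: "finite J" using J fin finite_subset by blast
  have sub: "inc C (J - \<alpha>) \<subseteq> inc C L" using J by (auto simp: inc_def)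
  have "insert k A \<union> J = (J - \<alpha>) \<union> (J \<inter> \<alpha> \<union> insert k A)" by blast
  then have "card (assignments c C (insert k A \<union> J)) = card (assignments c ?C (J \<inter> \<alpha> \<union> insert k A))"
    using card_assignments_tight[OF fin(1) _ _ tight(1), of "J \<inter> \<alpha> \<union> insert k A"] fJ fin J by auto
  also have "\<dots> = card (assignments c ?C (insert k A))"
  proof (rule card_assignments_forced[where \<alpha> = \<alpha>])
    have "insert k A \<inter> \<alpha> = {k}" using \<alpha> by blast
    then show "card (J \<inter> \<alpha>) + card (insert k A \<inter> \<alpha>) \<le> c" using c by simp
    show "\<beta> = \<alpha>" if "w \<in> J \<inter> \<alpha>" "\<beta> \<in> ?C" "w \<in> \<beta>" for w \<beta> using forced that by blast
  qed (use fJ fin J \<alpha> \<alpha>J in auto)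
  also have "\<dots> = card (assignments c ?C A) + card (assignments c (?C - {\<alpha>}) (insert k A))"
    using fin J \<alpha> \<alpha>J c by (intro card_assignments_insert) auto
  also have "assignments c ?C A = assignments c C A"
    using far sub by (intro assignments_cong) blast
  \<comment> \<open>For the vertices in \<open>A\<close> and for \<open>k\<close>, deleting these
    cells amounts to deleting all cells meeting \<open>L\<close>, by \<open>far\<close> and
    \<open>at_k\<close>; tightness then puts \<open>L\<close> back.\<close>
  also have "assignments c (?C - {\<alpha>}) (insert k A) = assignments c (C - inc C L) (insert k A)"
    using far at_k sub tight(3) by (intro assignments_cong) blast
  also have "card \<dots> = card (assignments c C (L \<union> insert k A))"
    using card_assignments_tight[OF fin(1) _ _ tight(2), of "insert k A"] fin J by (simp add: Int_commute)
  also have "L \<union> insert k A = insert k A \<union> L" by blast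
  finally show ?thesis .
qed

subsection \<open>Path counts and labels in a \<open>d\<close>-angulation\<close>

lemma between_split:
  assumes "k \<in> {1..n}" "l \<in> {1..n}" "v \<in> {1..n}" "cyc k v l"
  shows "between n k l = insert v (between n k v \<union> between n v l)" "between n k v \<inter> between n v l = {}"
proof -
  have ne: "k \<noteq> l" "k \<noteq> v" "v \<noteq> l" using cyc_distinct[OF assms(4)] by auto
  have vlk: "cyc v l k" using cyc_rot[OF assms(4)] .
  have "cyc k x l \<longleftrightarrow> x = v \<or> cyc k x v \<or> cyc v x l" for x
  proof
    assume x: "cyc k x l"
    then show "x = v \<or> cyc k x v \<or> cyc v x l"
      using cyc_total[of k x v] cyc_distinct[OF x] ne cyc_trans'[of k v x l] by blast
  next
    assume "x = v \<or> cyc k x v \<or> cyc v x l"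
    then consider "x = v" | "cyc k x v" | "cyc v x l" by blast
    then show "cyc k x l"
    proof cases
      case 2
      then show ?thesis using cyc_trans assms(4) by blast
    next
      case 3
      then show ?thesis using cyc_rot[OF cyc_rot[OF cyc_trans'[OF 3 vlk]]] by simp
    qed (use assms(4) in simp)
  qed
  then show "between n k l = insert v (between n k v \<union> between n v l)"
    using between_iff[OF assms(1,2) ne(1)] between_iff[OF assms(1,3) ne(2)] between_iff[OF assms(3,2) ne(3)] assms(3)
    by blast
  have "\<not> (cyc k x v \<and> cyc v x l)" for x
    using cyc_trans[OF _ vlk, of x] cyc_asym[of v k x] cyc_rot[OF cyc_rot, of k x v] by blast
  then show "between n k v \<inter> between n v l = {}"
    using between_iff[OF assms(1,3) ne(2)] between_iff[OF assms(3,2) ne(3)] by blast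
qed

lemma between_disjoint: 
  assumes "k \<in> {1..n}" "l \<in> {1..n}" "k \<noteq> l"
  shows "between n k l \<inter> between n l k = {}"
proof -
  have "\<not> (cyc k x l \<and> cyc l x k)" for x
    using cyc_asym[of k x l] cyc_rot[OF cyc_rot, of l x k] by blast
  then show ?thesis
    using between_iff[OF assms(1,2,3)] between_iff[OF assms(2,1) assms(3)[symmetric]] by blast
qed

lemma between_cases:
  assumes "k \<in> {1..n}" "l \<in> {1..n}" "k \<noteq> l" "x \<in> {1..n}"
  shows "x = k \<or> x = l \<or> x \<in> between n k l \<or> x \<in> between n l k"
  using assms cyc_total[of k x l] cyc_imp_between[of k x l n] cyc_imp_between[of l x k n] cyc_rot by blast

lemma between_endpoints: "k \<in> {1..n} \<Longrightarrow> l \<in> {1..n} \<Longrightarrow> k \<noteq> l \<Longrightarrow> k \<notin> between n k l \<and> l \<notin> between n k l"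
  by (simp add: between_iff)

lemma betweenD:
  assumes "v \<in> between n k l" "k \<in> {1..n}" "l \<in> {1..n}" "k \<noteq> l"
  shows "v \<in> {1..n}" "cyc k v l" "v \<noteq> k" "v \<noteq> l"
  using assms between_iff cyc_distinct by blast+

text \<open>Take as \<open>a\<close> the first vertex of \<alpha> after \<open>i\<close> and as
  \<open>b\<close> the last one before \<open>i\<close>. They differ because a further vertex of
  \<alpha> would otherwise lie on an arc free of \<alpha>.\<close>

lemma facing_side:
  assumes \<alpha>: "\<alpha> \<in> cells n T" and i: "i \<in> {1..n}" "i \<notin> \<alpha>"
  obtains a b where "a \<in> \<alpha>" "b \<in> \<alpha>" "a \<noteq> b" "i \<in> between n b a" "\<alpha> \<inter> between n b a = {}"
proof -
  note \<alpha>V = cellD(1)[OF \<alpha>]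
  obtain w0 where "w0 \<in> \<alpha>" using cell_other_vertex[OF \<alpha>] by metis
  then have ne: "\<alpha> - {i} \<noteq> {}" using i by blast
  obtain a where a: "a \<in> \<alpha>" "a \<noteq> i" "\<alpha> \<inter> between n i a = {}"
    using next_vertex[OF \<alpha>V i(1) ne] .
  obtain b where b: "b \<in> \<alpha>" "b \<noteq> i" "\<alpha> \<inter> between n b i = {}"
    using prev_vertex[OF \<alpha>V i(1) ne] .
  have V: "a \<in> {1..n}" "b \<in> {1..n}" using a b \<alpha>V by auto
  have ab: "a \<noteq> b"
  proof
    assume "a = b"
    obtain w where w: "w \<in> \<alpha>" "w \<noteq> i" "w \<noteq> a" using cell_other_vertex[OF \<alpha>] by metis
    then have "w \<in> {1..n}" using \<alpha>V by blast
    then have "w \<in> between n i a \<or> w \<in> between n a i"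
      using between_cases[OF i(1) V(1) a(2)[symmetric]] w by blast
    then show False using w(1) a(3) b(3) unfolding \<open>a = b\<close> by blast
  qed
  have "\<not> cyc b a i" using b(3) a(1) V i cyc_imp_between by blast
  then have c: "cyc b i a" using cyc_total[of b i a] a b ab by blast
  have "\<alpha> \<inter> between n b a = {}"
    unfolding between_split(1)[OF V(2,1) i(1) c] using a(3) b(3) i(2) by blast
  moreover have "i \<in> between n b a" using c V i cyc_imp_between by blast
  ultimately show ?thesis using that a b ab by blast
qed

section \<open>Tight pieces cut off by cells\<close>

locale polygon_angulation = polygon_dissection +
  fixes d :: nat
  assumes card_cell: "\<alpha> \<in> cells n T \<Longrightarrow> card \<alpha> = d"
    and d3: "d \<ge> 3" and n3: "n \<ge> 3"
begin

abbreviation "C \<equiv> cells n T"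
abbreviation "c \<equiv> d - 2"
abbreviation "num_paths i j \<equiv> card (assignments c C (between n i j))"

lemma cell_diff:
  assumes "\<alpha> \<in> C" "\<beta> \<in> C" "\<alpha> \<noteq> \<beta>" obtains u where "u \<in> \<beta>" "u \<notin> \<alpha>"
proof -
  have "\<not> \<beta> \<subseteq> \<alpha>"
    using card_subset_eq[OF cellD(3)[OF assms(1)], of \<beta>] card_cell assms by metis
  then show ?thesis using that by blast
qed

lemma card_cell_inner:
  assumes "\<alpha> \<in> C" "k \<in> \<alpha>" "l \<in> \<alpha>" "k \<noteq> l" shows "card (\<alpha> - {k, l}) = c"
  using assms cellD(3)[OF assms(1)] card_cell[OF assms(1)] by (simp add: card_Diff_subset)

lemma side_diagonal:
  assumes "\<alpha> \<in> C" "a \<in> \<alpha>" "b \<in> \<alpha>" "a \<noteq> b" "\<alpha> \<inter> between n b a = {}"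
    "between n a b \<noteq> {}" "between n b a \<noteq> {}"
  shows "{a, b} \<in> T"
proof -
  have "a \<in> {1..n}" "b \<in> {1..n}" using cellD(1)[OF assms(1)] assms by auto
  then have "{a, b} \<notin> polygon_edges n" using polygon_edge_iff assms(4,6,7) by blast
  then show ?thesis using cell_side[OF assms(1,3,2)] assms(4,5) by (simp add: insert_commute)
qed

text \<open>The vertices of \<beta> other than \<open>k\<close> and \<open>l\<close> number
  \<open>d - 2\<close>, the capacity of \<beta>, so they fill \<beta> by \<open>tight_fill\<close>.
  Separation is a hypothesis so that \<open>{k, l}\<close> may be a diagonal or the polygon edge
  between \<open>n\<close> and \<open>1\<close>.\<close>

lemma tight_beyond_side:
  assumes \<beta>: "\<beta> \<in> C" "k \<in> \<beta>" "l \<in> \<beta>" "k \<noteq> l" "\<beta> \<inter> between n l k = {}"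
    and sep: "\<And>\<gamma>. \<gamma> \<in> C \<Longrightarrow> \<gamma> \<inter> between n k l \<noteq> {} \<Longrightarrow> \<gamma> \<inter> between n l k = {}"
    and tight: "tight c C (between n k l - \<beta>)"
  shows "tight c C (between n k l)" "\<beta> \<in> inc C (between n k l)"
proof -
  have V: "k \<in> {1..n}" "l \<in> {1..n}" using \<beta> cellD(1) by blast+
  have Y: "between n k l \<inter> \<beta> = \<beta> - {k, l}"
    using between_cases[OF V \<beta>(4)] between_endpoints[OF V \<beta>(4)] \<beta>(5) cellD(1)[OF \<beta>(1)] by blast
  have cY: "card (between n k l \<inter> \<beta>) = c" using card_cell_inner[OF \<beta>(1-4)] Y by simp
  then have Yne: "between n k l \<inter> \<beta> \<noteq> {}" using d3 by auto
  then show "\<beta> \<in> inc C (between n k l)" using \<beta>(1) unfolding inc_def by blast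
  have "tight c C ((between n k l - \<beta>) \<union> (between n k l \<inter> \<beta>))"
  proof (rule tight_fill(1)[where \<alpha> = \<beta>])
    fix w \<gamma> assume w: "w \<in> between n k l \<inter> \<beta>" "\<gamma> \<in> C" "w \<in> \<gamma>"
    show "\<gamma> \<in> insert \<beta> (inc C (between n k l - \<beta>))"
    proof (cases "\<gamma> = \<beta>")
      case False
      then obtain u where u: "u \<in> \<gamma>" "u \<notin> \<beta>" using cell_diff[OF \<beta>(1) w(2)] by metis
      have "\<gamma> \<inter> between n l k = {}" using sep w by blast
      then have "u \<in> between n k l"
        using u between_cases[OF V \<beta>(4), of u] cellD(1)[OF w(2)] \<beta>(2,3) by blast
      then show ?thesis using u w(2) unfolding inc_def by blast
    qed simp
  next
    show "\<beta> \<notin> inc C (between n k l - \<beta>)" unfolding inc_def by blast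
  qed (use tight \<beta> cY Yne in auto)
  moreover have "(between n k l - \<beta>) \<union> (between n k l \<inter> \<beta>) = between n k l" by blast
  ultimately show "tight c C (between n k l)" by simp
qed

text \<open>The vertices off \<alpha> on an arc form the pieces beyond its sides, and tight pieces
  are glued together along the arc. The second conjunct keeps the cells of different pieces
  apart.\<close>

lemma tight_arc:
  assumes "\<alpha> \<in> C" "k \<in> \<alpha>" "l \<in> \<alpha>" "k \<noteq> l"
  shows "tight c C (between n k l - \<alpha>) \<and> (\<forall>\<beta>\<in>inc C (between n k l - \<alpha>). \<beta> \<inter> between n l k = {})"
  using assms
proof (induction rule: arc_induct)
  case (empty \<alpha> k l)
  then show ?case by (simp add: tight_def inc_def)
next
  case (split \<alpha> k l v)
  have V: "k \<in> {1..n}" "l \<in> {1..n}" "v \<in> {1..n}"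
    using split.hyps(2,3,5) cellD(1)[OF split.hyps(1)] by blast+
  have cy: "cyc k v l" using betweenD(2)[OF split.hyps(6) V(1,2) split.hyps(4)] .
  note b1 = between_split[OF V cy]
  note b2 = between_split[OF V(3,1,2) cyc_rot[OF cy]]
  note b3 = between_split[OF V(2,3,1) cyc_rot[OF cyc_rot[OF cy]]]
  have e: "between n k l - \<alpha> = (between n k v - \<alpha>) \<union> (between n v l - \<alpha>)"
    unfolding b1(1) using split.hyps(5) by blast
  have i: "inc C (between n k l - \<alpha>) = inc C (between n k v - \<alpha>) \<union> inc C (between n v l - \<alpha>)"
    unfolding e by (rule inc_Un)
  \<comment> \<open>A common cell would avoid both the arc from \<open>v\<close> to \<open>k\<close>
    and the arc from \<open>l\<close> to \<open>v\<close>. Together these contain every vertex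
    except \<open>v\<close>.\<close>
  have "inc C (between n k v - \<alpha>) \<inter> inc C (between n v l - \<alpha>) = {}"
  proof (rule ccontr)
    assume "\<not> ?thesis"
    then obtain \<beta> where \<beta>: "\<beta> \<in> inc C (between n k v - \<alpha>)" "\<beta> \<in> inc C (between n v l - \<alpha>)" by blast
    then have b: "\<beta> \<inter> between n v k = {}" "\<beta> \<inter> between n l v = {}" "\<beta> \<in> C"
      using split.IH unfolding inc_def by blast+
    obtain w where w: "w \<in> \<beta>" "w \<noteq> v" using cell_other_vertex[OF b(3)] by metis
    have "w \<in> {1..n}" using w cellD(1)[OF b(3)] by blast
    moreover have "v \<noteq> k" using cyc_distinct[OF cy] by blast
    ultimately have "w = k \<or> w \<in> between n k v" using between_cases[OF V(3,1), of w] w b(1) by blast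
    then have "w \<in> between n l v" unfolding b3(1) by blast
    then show False using w(1) b(2) by blast
  qed
  moreover have "(between n k v - \<alpha>) \<inter> (between n v l - \<alpha>) = {}" using b1 by blast
  ultimately have "tight c C (between n k l - \<alpha>)" unfolding e using split.IH by (intro tight_Un) auto
  moreover have "\<beta> \<inter> between n l k = {}" if "\<beta> \<in> inc C (between n k l - \<alpha>)" for \<beta>
  proof -
    have "\<beta> \<inter> between n v k = {} \<or> \<beta> \<inter> between n l v = {}" using that split.IH unfolding i by blast
    moreover have "between n l k \<subseteq> between n v k" unfolding b2(1) by blast
    moreover have "between n l k \<subseteq> between n l v" unfolding b3(1) by blast
    ultimately show ?thesis by blast
  qed
  ultimately show ?case by blast
next
  case (beyond \<alpha> \<beta> k l)
  have sep: "\<gamma> \<inter> between n l k = {}" if "\<gamma> \<in> C" "\<gamma> \<inter> between n k l \<noteq> {}" for \<gamma>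
    using cell_not_crossing[OF beyond.hyps(5) that(1)] that(2) by blast
  have "between n k l - \<alpha> = between n k l" using beyond by blast
  then show ?case using tight_beyond_side(1)[OF beyond.hyps(7-9,4,10) sep] beyond.IH sep by (auto simp: inc_def)
qed

text \<open>A vertex of \<alpha> off \<beta> would put \<alpha> into a piece beyond \<beta> on one
  side of \<open>v\<close>. By \<open>tight_arc\<close> such a cell cannot contain both
  \<open>a\<close> and \<open>b\<close>.\<close>

lemma cell_unique:
  assumes \<alpha>: "\<alpha> \<in> C" "a \<in> \<alpha>" "b \<in> \<alpha>" "\<alpha> \<inter> between n b a = {}"
    and \<beta>: "\<beta> \<in> C" "a \<in> \<beta>" "b \<in> \<beta>" "\<beta> \<inter> between n b a = {}" and ab: "a \<noteq> b"
  shows "\<alpha> = \<beta>"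
proof (rule ccontr)
  assume "\<alpha> \<noteq> \<beta>"
  then obtain u where u: "u \<in> \<alpha>" "u \<notin> \<beta>" using cell_diff \<alpha>(1) \<beta>(1) by metis
  have V: "a \<in> {1..n}" "b \<in> {1..n}" using \<alpha> cellD(1) by blast+
  have uab: "u \<in> between n a b"
    using between_cases[OF V ab, of u] u \<alpha>(4) \<beta>(2,3) cellD(1)[OF \<alpha>(1)] by blast
  obtain v where v: "v \<in> \<beta>" "v \<noteq> a" "v \<noteq> b" using cell_other_vertex[OF \<beta>(1)] by metis
  have vV: "v \<in> {1..n}" using v cellD(1)[OF \<beta>(1)] by blast
  have "v \<in> between n a b" using between_cases[OF V ab vV] v \<beta>(4) by blast
  then have cy: "cyc a v b" using betweenD V ab by blast
  have "u \<noteq> v" using u(2) v(1) by blast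
  then have "u \<in> between n a v - \<beta> \<or> u \<in> between n v b - \<beta>"
    using uab u(2) unfolding between_split(1)[OF V vV cy] by blast
  then have "\<alpha> \<in> inc C (between n a v - \<beta>) \<or> \<alpha> \<in> inc C (between n v b - \<beta>)"
    using u \<alpha>(1) unfolding inc_def by blast
  then have "\<alpha> \<inter> between n v a = {} \<or> \<alpha> \<inter> between n b v = {}"
    using tight_arc[OF \<beta>(1,2) v(1)] tight_arc[OF \<beta>(1) v(1) \<beta>(3)] v by metis
  moreover have "b \<in> between n v a" "a \<in> between n b v"
    using cy V vV cyc_imp_between cyc_rot by blast+
  ultimately show False using \<alpha>(2,3) by blast
qed

text \<open>Another cell through \<open>w\<close> has a vertex off \<alpha>. If that vertex were on
  the opposite arc, \<open>tight_arc\<close> would keep the cell away from \<open>w\<close>.\<close>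

lemma cell_at_chord_vertex:
  assumes \<alpha>: "\<alpha> \<in> C" "k \<in> \<alpha>" "l \<in> \<alpha>" "k \<noteq> l" and w: "w \<in> between n k l \<inter> \<alpha>"
    and \<gamma>: "\<gamma> \<in> C" "w \<in> \<gamma>"
  shows "\<gamma> \<in> insert \<alpha> (inc C (between n k l - \<alpha>))"
proof (cases "\<gamma> = \<alpha>")
  case False
  have V: "k \<in> {1..n}" "l \<in> {1..n}" using \<alpha> cellD(1) by blast+
  obtain u where u: "u \<in> \<gamma>" "u \<notin> \<alpha>" using False cell_diff \<alpha>(1) \<gamma>(1) by metis
  have uV: "u \<in> {1..n}" using u cellD(1)[OF \<gamma>(1)] by blast
  consider "u \<in> between n k l" | "u \<in> between n l k" using between_cases[OF V \<alpha>(4) uV] u \<alpha> by blast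
  then show ?thesis
  proof cases
    case 1
    then show ?thesis using u \<gamma> unfolding inc_def by blast
  next
    case 2
    then have "\<gamma> \<in> inc C (between n l k - \<alpha>)" using u \<gamma> unfolding inc_def by blast
    then have "\<gamma> \<inter> between n k l = {}" using tight_arc[OF \<alpha>(1,3,2)] \<alpha>(4) by metis
    then show ?thesis using w \<gamma>(2) by blast
  qed
qed simp

section \<open>Path counts within a cell and across a side\<close>

text \<open>The vertices off \<alpha> are tight; the at most \<open>d - 2\<close> vertices on
  \<alpha> are then forced into \<alpha>.\<close>

lemma num_paths_chord:
  assumes \<alpha>: "\<alpha> \<in> C" "k \<in> \<alpha>" "l \<in> \<alpha>" "k \<noteq> l"
  shows "num_paths k l = 1"
proof -
  let ?I = "between n k l - \<alpha>" and ?Y = "between n k l \<inter> \<alpha>"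
  have V: "k \<in> {1..n}" "l \<in> {1..n}" using \<alpha> cellD(1) by blast+
  have "between n k l = ?I \<union> ?Y" by blast
  then have "num_paths k l = card (assignments c (C - inc C ?I) (?Y \<union> {}))"
    using card_assignments_tight[of C ?Y ?I c] tight_arc[OF \<alpha>] by auto
  also have "\<dots> = card (assignments c (C - inc C ?I) {})"
  proof (rule card_assignments_forced[where \<alpha> = \<alpha>])
    show "\<alpha> \<in> C - inc C ?I" using \<alpha> unfolding inc_def by blast
    show "\<beta> = \<alpha>" if "w \<in> ?Y" "\<beta> \<in> C - inc C ?I" "w \<in> \<beta>" for w \<beta>
      using cell_at_chord_vertex[OF \<alpha>] that by blast
    have "?Y \<subseteq> \<alpha> - {k, l}" using between_endpoints[OF V \<alpha>(4)] by blast
    then show "card ?Y + card ({} \<inter> \<alpha>) \<le> c"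
      using card_mono[of "\<alpha> - {k, l}" ?Y] cellD(3)[OF \<alpha>(1)] card_cell_inner[OF \<alpha>] by simp
  qed auto
  finally show ?thesis by simp
qed

lemma num_paths_step:
  assumes i: "i \<in> {1..n}" and \<alpha>: "\<alpha> \<in> C" "k \<in> \<alpha>" "l \<in> \<alpha>" "k \<noteq> l" "\<alpha> \<inter> between n l k = {}" "i \<in> between n l k"
    and v: "v \<in> \<alpha>" "v \<noteq> k" "v \<noteq> l"
  shows "num_paths i v = num_paths i k + num_paths i l"
    and "num_paths v i = num_paths k i + num_paths l i"
proof -
  have V: "k \<in> {1..n}" "l \<in> {1..n}" "v \<in> {1..n}" using \<alpha> v cellD(1) by blast+
  have vkl: "v \<in> between n k l" using between_cases[OF V(1,2) \<alpha>(4) V(3)] v \<alpha>(5) by blast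
  have cv: "cyc k v l" using betweenD vkl V \<alpha>(4) by blast
  have ci: "cyc l i k" using betweenD \<alpha>(4,6) V by metis
  have T: "{k, l} \<in> T" using side_diagonal[OF \<alpha>(1-5)] vkl \<alpha>(6) by blast
  let ?L = "between n k l"
  have sep: "\<gamma> \<inter> between n l k = {}" if "\<gamma> \<in> C" "\<gamma> \<inter> ?L \<noteq> {}" for \<gamma>
    using cell_not_crossing[OF T that(1)] that(2) by blast
  have sep': "\<gamma> \<inter> between n l k = {}" if "\<gamma> \<in> inc C ?L" for \<gamma>
    using sep that unfolding inc_def by blast
  note L = tight_beyond_side[OF \<alpha>(1-5) sep conjunct1[OF tight_arc[OF \<alpha>(1-4)]]]
  note bi = between_split[OF V(2,1) i ci]
  note bv = between_split[OF V cv]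
  have disj: "?L \<inter> between n l k = {}" using between_disjoint[OF V(1,2) \<alpha>(4)] .
  have ends: "k \<notin> ?L" "l \<notin> ?L" "k \<notin> between n l k" "l \<notin> between n l k"
    using between_endpoints V \<alpha>(4) by auto
  have inner: "u \<in> between n k v - \<alpha> \<or> u \<in> between n v l - \<alpha>"
    if "\<beta> \<in> inc C ?L" "u \<in> \<beta>" "u \<notin> \<alpha>" for \<beta> u
  proof -
    have "u \<in> {1..n}" using that cellD(1) unfolding inc_def by blast
    then have "u \<in> ?L" using between_cases[OF V(1,2) \<alpha>(4), of u] sep'[OF that(1)] that \<alpha>(2,3) by blast
    moreover have "u \<noteq> v" using that(3) v(1) by blast
    ultimately show ?thesis using that(3) unfolding bv(1) by blast
  qed
  \<comment> \<open>Besides \<open>k\<close> and \<open>l\<close>, also \<open>v\<close> is missing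
    from \<open>J\<close>, which leaves \<alpha> one free place.\<close>
  have small: "card (J \<inter> \<alpha>) < c" if "J \<subseteq> ?L - {v}" for J
  proof -
    have "J \<inter> \<alpha> \<subseteq> \<alpha> - {k, l} - {v}" using that ends by blast
    then have "card (J \<inter> \<alpha>) \<le> card (\<alpha> - {k, l} - {v})"
      using cellD(3)[OF \<alpha>(1)] by (intro card_mono) auto
    also have "\<dots> = c - 1" using card_cell_inner[OF \<alpha>(1-4)] v cellD(3)[OF \<alpha>(1)] by (subst card_Diff_singleton) auto
    finally show ?thesis using d3 by linarith
  qed
  have vk: "v \<notin> between n k v" "v \<notin> between n v l" using between_endpoints V v(2,3) by blast+
  have "cyc k v i" using cyc_trans[OF cv] ci cyc_rot by blast
  then have ckv: "cyc i k v" using cyc_rot by blast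
  have "cyc l i v" using cyc_trans[OF ci] cv cyc_rot by blast
  then have clv: "cyc v l i" using cyc_rot by blast
  have ckl: "cyc i k l" "cyc k l i" using ci cyc_rot by blast+
  have kin: "k \<in> between n l v" "l \<in> between n v k" using cv V cyc_imp_between cyc_rot by blast+
  have "card (assignments c C (insert k (between n i k) \<union> between n k v)) =
      num_paths i k + card (assignments c C (insert k (between n i k) \<union> ?L))"
  proof (rule card_assignments_recursion[where \<alpha> = \<alpha>])
    show "tight c C (between n k v - \<alpha>)" using tight_arc[OF \<alpha>(1,2) v(1)] v by blast
    \<comment> \<open>The remaining cells meeting \<open>?L\<close> would lie beyond \<alpha>
      between \<open>v\<close> and \<open>l\<close>, and such cells cannot reach
      \<open>k\<close>.\<close>
    show "\<beta> \<in> insert \<alpha> (inc C (between n k v - \<alpha>))" if "\<beta> \<in> inc C ?L" "k \<in> \<beta>" for \<beta>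
    proof (rule ccontr)
      assume n: "\<beta> \<notin> insert \<alpha> (inc C (between n k v - \<alpha>))"
      have \<beta>: "\<beta> \<in> C" using that unfolding inc_def by blast
      obtain u where u: "u \<in> \<beta>" "u \<notin> \<alpha>" using n cell_diff[OF \<alpha>(1) \<beta>] by blast
      then have "u \<in> between n v l - \<alpha>" using inner[OF that(1)] n \<beta> unfolding inc_def by blast
      then have "\<beta> \<in> inc C (between n v l - \<alpha>)" using u \<beta> unfolding inc_def by blast
      then have "\<beta> \<inter> between n l v = {}" using tight_arc[OF \<alpha>(1) v(1) \<alpha>(3)] v by blast
      then show False using that kin by blast
    qed
    show "\<beta> \<in> insert \<alpha> (inc C (between n k v - \<alpha>))" if "w \<in> between n k v \<inter> \<alpha>" "\<beta> \<in> C" "w \<in> \<beta>" for w \<beta>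
      using cell_at_chord_vertex[OF \<alpha>(1,2) v(1) _ that] v by blast
    show "card (between n k v \<inter> \<alpha>) < c" using small bv vk by blast
    show "between n i k \<inter> \<beta> = {}" if "\<beta> \<in> inc C ?L" for \<beta> using sep'[OF that] bi(1) by blast
    show "\<alpha> \<notin> inc C (between n k v - \<alpha>)" unfolding inc_def by blast
  qed (use L \<alpha> bi(1) bv(1) disj ends in auto)
  then show "num_paths i v = num_paths i k + num_paths i l"
    using between_split(1)[OF i V(3,1) ckv] between_split(1)[OF i V(2,1) ckl(1)] by simp
  \<comment> \<open>The mirror image: now the case distinction is made at \<open>l\<close>.\<close>
  have "card (assignments c C (insert l (between n l i) \<union> between n v l)) =
      num_paths l i + card (assignments c C (insert l (between n l i) \<union> ?L))"
  proof (rule card_assignments_recursion[where \<alpha> = \<alpha>])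
    show "tight c C (between n v l - \<alpha>)" using tight_arc[OF \<alpha>(1) v(1) \<alpha>(3)] v by blast
    show "\<beta> \<in> insert \<alpha> (inc C (between n v l - \<alpha>))" if "\<beta> \<in> inc C ?L" "l \<in> \<beta>" for \<beta>
    proof (rule ccontr)
      assume n: "\<beta> \<notin> insert \<alpha> (inc C (between n v l - \<alpha>))"
      have \<beta>: "\<beta> \<in> C" using that unfolding inc_def by blast
      obtain u where u: "u \<in> \<beta>" "u \<notin> \<alpha>" using n cell_diff[OF \<alpha>(1) \<beta>] by blast
      then have "u \<in> between n k v - \<alpha>" using inner[OF that(1)] n \<beta> unfolding inc_def by blast
      then have "\<beta> \<in> inc C (between n k v - \<alpha>)" using u \<beta> unfolding inc_def by blast
      then have "\<beta> \<inter> between n v k = {}" using tight_arc[OF \<alpha>(1,2) v(1)] v by blast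
      then show False using that kin by blast
    qed
    show "\<beta> \<in> insert \<alpha> (inc C (between n v l - \<alpha>))" if "w \<in> between n v l \<inter> \<alpha>" "\<beta> \<in> C" "w \<in> \<beta>" for w \<beta>
      using cell_at_chord_vertex[OF \<alpha>(1) v(1) \<alpha>(3) _ that] v by blast
    show "card (between n v l \<inter> \<alpha>) < c" using small bv vk by blast
    show "between n l i \<inter> \<beta> = {}" if "\<beta> \<in> inc C ?L" for \<beta> using sep'[OF that] bi(1) by blast
    show "\<alpha> \<notin> inc C (between n v l - \<alpha>)" unfolding inc_def by blast
  qed (use L \<alpha> bi(1) bv(1) disj ends in auto)
  moreover have "between n v i = insert l (between n l i) \<union> between n v l"
    "between n k i = insert l (between n l i) \<union> ?L"
    using between_split(1)[OF V(3) i V(2) clv] between_split(1)[OF V(1) i V(2) ckl(2)] by auto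
  ultimately show "num_paths v i = num_paths k i + num_paths l i" by simp
qed

section \<open>The number of cells, and closed paths\<close>

lemma base_cell:
  obtains \<alpha> where "\<alpha> \<in> C" "1 \<in> \<alpha>" "n \<in> \<alpha>" "between n n 1 = {}" "between n 1 n = {1<..<n}"
proof -
  have b: "between n n 1 = {}" "between n 1 n = {1<..<n}" using n3 by (auto simp: between_def)
  have V: "1 \<in> {1..n}" "n \<in> {1..n}" "1 \<noteq> n" using n3 by auto
  have "2 \<in> between n 1 n" using n3 unfolding b(2) by simp
  then have ne: "between n 1 n \<noteq> {}" by blast
  have "{1, n} \<in> polygon_edges n \<union> T" using polygon_edge_iff[OF V] b(1) by blast
  then show ?thesis using cell_beyond[OF V _ ne] b that by metis
qed

text \<open>Seen from the edge between \<open>n\<close> and \<open>1\<close>, the other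
  \<open>n - 2\<close> vertices form a tight set, and every cell has a third vertex among
  them.\<close>

lemma card_cells: "n - 2 = c * card C"
proof -
  obtain \<alpha> where \<alpha>: "\<alpha> \<in> C" "1 \<in> \<alpha>" "n \<in> \<alpha>" and b: "between n n 1 = {}" "between n 1 n = {1<..<n}"
    using base_cell .
  have n1: "1 \<noteq> n" using n3 by simp
  have "tight c C (between n 1 n)"
    using tight_beyond_side(1)[OF \<alpha> n1] tight_arc[OF \<alpha> n1] b(1) by simp
  moreover have "inc C (between n 1 n) = C"
  proof (intro equalityI subsetI)
    fix \<beta> assume \<beta>: "\<beta> \<in> C"
    obtain w where w: "w \<in> \<beta>" "w \<noteq> 1" "w \<noteq> n" using cell_other_vertex[OF \<beta>] by metis
    then have "w \<in> between n 1 n" using cellD(1)[OF \<beta>] unfolding b(2) by force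
    then show "\<beta> \<in> inc C (between n 1 n)" using \<beta> w unfolding inc_def by blast
  qed (simp add: inc_def)
  ultimately show ?thesis unfolding tight_def b(2) by (simp add: numeral_2_eq_2)
qed

text \<open>Pigeonhole: \<open>n - 1\<close> vertices need a place, while the total capacity is
  \<open>n - 2\<close>.\<close>

lemma num_paths_self:
  assumes "i \<in> {1..n}" shows "num_paths i i = 0"
proof -
  have "p \<notin> assignments c C (between n i i)" for p
  proof
    assume p: "p \<in> assignments c C (between n i i)"
    have "between n i i = {1..n} - {i}" using assms by (auto simp: between_def)
    then have "n - 1 = card (between n i i)" using assms by simp
    also have "\<dots> = (\<Sum>\<beta>\<in>C. card {x \<in> between n i i. p x = \<beta>})"
      using sum.group[of "between n i i" C p "\<lambda>_. 1::nat"] assignmentsD(1)[OF p] by (simp add: image_subset_iff)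
    also have "\<dots> \<le> (\<Sum>\<beta>\<in>C. c)" by (intro sum_mono assignmentsD(4)[OF p])
    also have "\<dots> = n - 2" using card_cells by (simp add: mult.commute)
    finally show False using n3 by linarith
  qed
  then have "assignments c C (between n i i) = {}" by blast
  then show ?thesis by (simp only: card.empty)
qed

section \<open>Totality and values of the labelling procedure\<close>

text \<open>A diagonal hands its two endpoints on to the next cell, so \<open>D\<close> spreads over
  the whole polygon along \<open>arc_induct\<close>.\<close>

lemma all_vertices_reached:
  assumes "\<alpha> \<in> C" "\<alpha> \<subseteq> D"
    and closed: "\<And>\<beta> k l. \<beta> \<in> C \<Longrightarrow> k \<in> \<beta> \<Longrightarrow> l \<in> \<beta> \<Longrightarrow> k \<noteq> l \<Longrightarrow> k \<in> D \<Longrightarrow> l \<in> D \<Longrightarrow> \<beta> \<subseteq> D"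
  shows "{1..n} \<subseteq> D"
proof -
  have arc: "\<alpha> \<subseteq> D \<longrightarrow> between n k l \<subseteq> D" if "\<alpha> \<in> C" "k \<in> \<alpha>" "l \<in> \<alpha>" "k \<noteq> l" for \<alpha> k l
    using that
  proof (induction rule: arc_induct)
    case (split \<alpha> k l v)
    have V: "k \<in> {1..n}" "l \<in> {1..n}" "v \<in> {1..n}"
      using split.hyps(2,3,5) cellD(1)[OF split.hyps(1)] by blast+
    have "cyc k v l" using betweenD(2)[OF split.hyps(6) V(1,2) split.hyps(4)] .
    then show ?case unfolding between_split(1)[OF V \<open>cyc k v l\<close>] using split.IH split.hyps(5) by blast
  next
    case (beyond \<alpha> \<beta> k l)
    then show ?case using closed[of \<beta> k l] by blast
  qed simp
  obtain k where k: "k \<in> \<alpha>" using cell_other_vertex[OF assms(1)] by metis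
  obtain l where l: "l \<in> \<alpha>" "l \<noteq> k" using cell_other_vertex[OF assms(1)] by metis
  have "k \<in> {1..n}" "l \<in> {1..n}" using k l cellD(1)[OF assms(1)] by blast+
  then show ?thesis using between_cases[of k n l] arc[OF assms(1) k l(1)] arc[OF assms(1) l(1) k] assms(2) k l by blast
qed

lemma cell_at_vertex:
  assumes "i \<in> {1..n}" obtains \<alpha> where "\<alpha> \<in> C" "i \<in> \<alpha>"
proof -
  obtain \<alpha> where "\<alpha> \<in> C" using base_cell .
  then have "{1..n} \<subseteq> \<Union>C" by (intro all_vertices_reached) auto
  then show ?thesis using assms that by blast
qed

lemma labelling_total:
  assumes i: "i \<in> {1..n}"
  obtains f where "labelling n T i f" "{1..n} \<subseteq> dom f"
proof -
  have dom: "dom f \<subseteq> {1..n}" if "labelling n T i f" for f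
    using that
  proof induction
    case start
    then show ?case using i cellD(1) by (fastforce simp: dom_def split: if_splits)
  next
    case (step f \<alpha>)
    then show ?case using cellD(1)[OF step.hyps(2)] by (fastforce simp: dom_def split: if_splits)
  qed
  \<comment> \<open>A labelling with the largest domain is chosen; any gap could be filled by a
    further step. The bound is \<open>Suc n\<close> because \<open>ex_has_greatest_nat\<close> asks
    for a strict one.\<close>
  have "\<forall>f. labelling n T i f \<longrightarrow> card (dom f) < Suc n"
    using card_mono[OF _ dom] by (simp add: less_Suc_eq_le)
  then have "\<exists>f. labelling n T i f \<and> (\<forall>g. labelling n T i g \<longrightarrow> card (dom g) \<le> card (dom f))"
    by (rule ex_has_greatest_nat[where P = "labelling n T i", OF labelling.start])
  then obtain f where f: "labelling n T i f"
    "\<And>g. labelling n T i g \<Longrightarrow> card (dom g) \<le> card (dom f)"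
    by blast
  have start: "\<forall>\<alpha>\<in>C. i \<in> \<alpha> \<longrightarrow> \<alpha> \<subseteq> dom g" if "labelling n T i g" for g
    using that
  proof induction
    case start
    then show ?case by (auto simp: dom_def)
  next
    case (step f \<alpha>)
    then show ?case by (fastforce simp: dom_def)
  qed
  obtain \<alpha> where \<alpha>: "\<alpha> \<in> C" "i \<in> \<alpha>" using cell_at_vertex[OF i] .
  have "{1..n} \<subseteq> dom f"
  proof (rule all_vertices_reached[OF \<alpha>(1)])
    show "\<alpha> \<subseteq> dom f" using start[OF f(1)] \<alpha> by blast
    fix \<beta> k l assume \<beta>: "\<beta> \<in> C" "k \<in> \<beta>" "l \<in> \<beta>" "k \<noteq> l" "k \<in> dom f" "l \<in> dom f"
    show "\<beta> \<subseteq> dom f"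
    proof (rule ccontr)
      assume "\<not> ?thesis"
      then obtain v where v: "v \<in> \<beta>" "v \<notin> dom f" by blast
      obtain x y where xy: "f k = Some x" "f l = Some y" using \<beta>(5,6) by blast
      let ?g = "\<lambda>v. if v \<in> \<beta> \<and> f v = None then Some (x + y) else f v"
      have g: "labelling n T i ?g" using labelling.step[OF f(1) \<beta>(1-4) xy] .
      have "dom ?g = dom f \<union> \<beta>" by (auto simp: dom_def)
      then have "dom f \<subset> dom ?g" using v by blast
      moreover have "finite (dom ?g)" using dom[OF g] by (rule finite_subset) simp
      ultimately have "card (dom f) < card (dom ?g)" by (rule psubset_card_mono[rotated])
      then show False using f(2)[OF g] by simp
    qed
  qed
  then show ?thesis using that f(1) by blast
qed

text \<open>The third invariant says that the labelled region grows outwards from \<open>i\<close>: nothing beyond the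
  side \<open>{a, b}\<close> by which \<open>\<alpha>\<close> faces \<open>i\<close> is labelled before all of \<open>\<alpha>\<close> is. Hence the two labelled
  vertices used in a productive step are always \<open>a\<close> and \<open>b\<close>.\<close>

lemma labelling_value:
  assumes lab: "labelling n T i f" and i: "i \<in> {1..n}"
    and self: "g i = 0" and chord: "\<And>\<alpha> v. \<alpha> \<in> C \<Longrightarrow> i \<in> \<alpha> \<Longrightarrow> v \<in> \<alpha> \<Longrightarrow> v \<noteq> i \<Longrightarrow> g v = 1"
    and rec: "\<And>\<alpha> a b v. \<alpha> \<in> C \<Longrightarrow> a \<in> \<alpha> \<Longrightarrow> b \<in> \<alpha> \<Longrightarrow> a \<noteq> b \<Longrightarrow> \<alpha> \<inter> between n b a = {} \<Longrightarrow>
      i \<in> between n b a \<Longrightarrow> v \<in> \<alpha> \<Longrightarrow> v \<noteq> a \<Longrightarrow> v \<noteq> b \<Longrightarrow> g v = g a + g b"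
  shows "(\<forall>v x. f v = Some x \<longrightarrow> x = g v) \<and>
    (\<forall>\<alpha>\<in>C. i \<in> \<alpha> \<longrightarrow> \<alpha> \<subseteq> dom f) \<and>
    (\<forall>\<alpha>\<in>C. \<forall>a\<in>\<alpha>. \<forall>b\<in>\<alpha>. a \<noteq> b \<longrightarrow> \<alpha> \<inter> between n b a = {} \<longrightarrow> i \<in> between n b a \<longrightarrow>
      dom f \<inter> between n a b \<noteq> {} \<longrightarrow> \<alpha> \<subseteq> dom f)"
  using lab
proof induction
  case start
  let ?f = "\<lambda>v. if v = i then Some 0 else if \<exists>\<alpha>\<in>C. i \<in> \<alpha> \<and> v \<in> \<alpha> then Some (1::nat) else None"
  \<comment> \<open>A vertex labelled at the start shares a cell with \<open>i\<close>; beyond a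
    side facing \<open>i\<close>, that cell would cross the diagonal.\<close>
  have False if h: "\<alpha> \<in> C" "a \<in> \<alpha>" "b \<in> \<alpha>" "a \<noteq> b" "\<alpha> \<inter> between n b a = {}" "i \<in> between n b a"
    "w \<in> dom ?f" "w \<in> between n a b" for \<alpha> a b w
  proof -
    have V: "a \<in> {1..n}" "b \<in> {1..n}" using h cellD(1) by blast+
    have "w \<noteq> i" using between_disjoint[OF V h(4)] h by blast
    then obtain \<gamma> where \<gamma>: "\<gamma> \<in> C" "i \<in> \<gamma>" "w \<in> \<gamma>" using h(7) by (auto simp: dom_def split: if_splits)
    have "{a, b} \<in> T" using side_diagonal[OF h(1-5)] h by blast
    then show False using cell_not_crossing[OF _ \<gamma>(1,3) h(8)] \<gamma> h by blast
  qed
  then have "\<forall>\<alpha>\<in>C. \<forall>a\<in>\<alpha>. \<forall>b\<in>\<alpha>. a \<noteq> b \<longrightarrow> \<alpha> \<inter> between n b a = {} \<longrightarrow> i \<in> between n b a \<longrightarrow>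
      dom ?f \<inter> between n a b \<noteq> {} \<longrightarrow> \<alpha> \<subseteq> dom ?f" by blast
  moreover have "\<forall>v x. ?f v = Some x \<longrightarrow> x = g v" using self chord by auto
  moreover have "\<forall>\<alpha>\<in>C. i \<in> \<alpha> \<longrightarrow> \<alpha> \<subseteq> dom ?f" by (auto simp: dom_def)
  ultimately show ?case by blast
next
  case (step f \<alpha> k l x y)
  let ?f = "\<lambda>v. if v \<in> \<alpha> \<and> f v = None then Some (x + y) else f v"
  have val: "z = g v" if "f v = Some z" for v z using conjunct1[OF step.IH] that by blast
  have at_i: "\<beta> \<subseteq> dom f" if "\<beta> \<in> C" "i \<in> \<beta>" for \<beta>
    using conjunct1[OF conjunct2[OF step.IH]] that by blast
  have inv: "\<beta> \<subseteq> dom f" if "\<beta> \<in> C" "a \<in> \<beta>" "b \<in> \<beta>" "a \<noteq> b" "\<beta> \<inter> between n b a = {}"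
    "i \<in> between n b a" "w \<in> dom f" "w \<in> between n a b" for \<beta> a b w
    using conjunct2[OF conjunct2[OF step.IH]] that by blast
  have domf: "dom ?f = dom f \<union> \<alpha>" by (auto simp: dom_def)
  show ?case
  proof (cases "\<alpha> \<subseteq> dom f")
    case True
    then have e: "(if v \<in> \<alpha> \<and> f v = None then Some (x + y) else f v) = f v" for v by auto
    show ?thesis unfolding e by (rule step.IH)
  next
    case False
    then have "i \<notin> \<alpha>" using at_i step.hyps by blast
    then obtain a b where ab: "a \<in> \<alpha>" "b \<in> \<alpha>" "a \<noteq> b" "i \<in> between n b a" "\<alpha> \<inter> between n b a = {}"
      using facing_side[OF step.hyps(2) i] by metis
    have V: "a \<in> {1..n}" "b \<in> {1..n}" using ab cellD(1)[OF step.hyps(2)] by auto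
    have old: "v = a \<or> v = b" if "v \<in> \<alpha>" "v \<in> dom f" for v
    proof -
      have "v \<notin> between n a b" using inv[OF step.hyps(2) ab(1-3,5,4) that(2)] False by blast
      moreover have "v \<in> {1..n}" using that cellD(1)[OF step.hyps(2)] by blast
      ultimately show ?thesis using between_cases[OF V ab(3), of v] ab(5) that by blast
    qed
    have "k \<in> dom f" "l \<in> dom f" using step.hyps by auto
    then have kl: "{k, l} = {a, b}" using old step.hyps by blast
    have "x = g k" "y = g l" using val step.hyps by auto
    then have xy: "x + y = g a + g b" using kl by (auto simp: doubleton_eq_iff)
    have abf: "a \<in> dom f" "b \<in> dom f" using kl \<open>k \<in> dom f\<close> \<open>l \<in> dom f\<close> by (auto simp: doubleton_eq_iff)
    have V1: "z = g v" if z: "?f v = Some z" for v z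
    proof (cases "v \<in> \<alpha> \<and> f v = None")
      case True
      then have "v \<noteq> a" "v \<noteq> b" using abf by auto
      then have "g v = g a + g b" using rec[OF step.hyps(2) ab(1-3,5,4)] True by blast
      then show ?thesis using z True xy by simp
    next
      case False
      then show ?thesis using z val by (simp split: if_splits)
    qed
    have V2: "\<forall>\<beta>\<in>C. i \<in> \<beta> \<longrightarrow> \<beta> \<subseteq> dom ?f" using at_i unfolding domf by blast
    \<comment> \<open>Let \<open>w\<close> be a new vertex of \<alpha> beyond the side
      \<open>{a', b'}\<close> of \<beta>. Either an endpoint of the side by which \<alpha> faces
      \<open>i\<close> is already labelled beyond \<open>{a', b'}\<close>, or the two sides coincide
      and \<alpha> equals \<beta>.\<close>
    have V3: "\<beta> \<subseteq> dom ?f" if \<beta>: "\<beta> \<in> C" "a' \<in> \<beta>" "b' \<in> \<beta>" "a' \<noteq> b'" "\<beta> \<inter> between n b' a' = {}"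
      "i \<in> between n b' a'" and w: "w \<in> dom ?f" "w \<in> between n a' b'" for \<beta> a' b' w
    proof (cases "w \<in> dom f")
      case True
      then show ?thesis using inv[OF \<beta> _ w(2)] unfolding domf by blast
    next
      case False
      then have "w \<in> \<alpha>" using w(1) unfolding domf by blast
      have V': "a' \<in> {1..n}" "b' \<in> {1..n}" using \<beta> cellD(1)[OF \<beta>(1)] by auto
      have "{a', b'} \<in> T" using side_diagonal[OF \<beta>(1-5)] \<beta>(6) w(2) by blast
      then have sep: "\<alpha> \<inter> between n b' a' = {}"
        using cell_not_crossing[OF _ step.hyps(2) \<open>w \<in> \<alpha>\<close> w(2)] by blast
      consider "a \<in> between n a' b' \<or> b \<in> between n a' b'" | "a \<in> {a', b'}" "b \<in> {a', b'}"
        using between_cases[OF V' \<beta>(4) V(1)] between_cases[OF V' \<beta>(4) V(2)] sep ab(1,2) by blast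
      then show ?thesis
      proof cases
        case 1
        then show ?thesis using inv[OF \<beta>] abf unfolding domf by blast
      next
        case 2
        have "a = a' \<and> b = b'"
        proof (rule ccontr)
          assume "\<not> ?thesis"
          then have "a = b'" "b = a'" using 2 ab(3) by auto
          then show False using between_disjoint[OF V' \<beta>(4)] \<beta>(6) ab(4) by blast
        qed
        then have "\<alpha> = \<beta>" using cell_unique[OF step.hyps(2) ab(1,2,5) \<beta>(1) _ _ _ ab(3)] \<beta> by blast
        then show ?thesis unfolding domf by blast
      qed
    qed
    show ?thesis
    proof (intro conjI allI ballI impI)
      fix \<beta> a' b' assume "\<beta> \<in> C" "a' \<in> \<beta>" "b' \<in> \<beta>" "a' \<noteq> b'" "\<beta> \<inter> between n b' a' = {}"
        "i \<in> between n b' a'" "dom ?f \<inter> between n a' b' \<noteq> {}"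
      then show "\<beta> \<subseteq> dom ?f" using V3[of \<beta> a' b'] by blast
    qed (use V1 V2 in blast)+
  qed
qed

text \<open>Keeping \<open>g\<close> arbitrary allows its use for both the rows and the columns of
  the path matrix. All runs agree with \<open>g\<close>, and a total run exists, so the
  \<open>THE\<close> is well defined.\<close>

lemma label_eq:
  assumes i: "i \<in> {1..n}" and v: "v \<in> {1..n}"
    and g: "g i = 0" "\<And>\<alpha> v. \<alpha> \<in> C \<Longrightarrow> i \<in> \<alpha> \<Longrightarrow> v \<in> \<alpha> \<Longrightarrow> v \<noteq> i \<Longrightarrow> g v = 1"
      "\<And>\<alpha> a b v. \<alpha> \<in> C \<Longrightarrow> a \<in> \<alpha> \<Longrightarrow> b \<in> \<alpha> \<Longrightarrow> a \<noteq> b \<Longrightarrow> \<alpha> \<inter> between n b a = {} \<Longrightarrow>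
      i \<in> between n b a \<Longrightarrow> v \<in> \<alpha> \<Longrightarrow> v \<noteq> a \<Longrightarrow> v \<noteq> b \<Longrightarrow> g v = g a + g b"
  shows "label n T i v = g v"
proof -
  have "\<forall>v x. f v = Some x \<longrightarrow> x = g v" if "labelling n T i f" for f
    by (rule conjunct1, rule labelling_value[where g = g, OF that i]) (rule g; assumption)+
  then have val: "x = g v" if "labelling n T i f" "f v = Some x" for f x using that by blast
  obtain f where f: "labelling n T i f" "{1..n} \<subseteq> dom f" using labelling_total[OF i] .
  then obtain x where x: "f v = Some x" using v by blast
  show ?thesis
    unfolding label_def using val f(1) x by (intro the_equality) blast+
qed

lemma label_eq_num_paths:
  assumes "i \<in> {1..n}" "v \<in> {1..n}"
  shows "label n T i v = num_paths i v" "label n T i v = num_paths v i"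
proof -
  note self = num_paths_self[OF assms(1)]
  note step = num_paths_step[OF assms(1)]
  show "label n T i v = num_paths i v"
    by (rule label_eq[OF assms, where g = "num_paths i", OF self]) (rule num_paths_chord step(1); assumption?; simp)+
  show "label n T i v = num_paths v i"
    by (rule label_eq[OF assms, where g = "\<lambda>v. num_paths v i", OF self])
      (rule num_paths_chord step(2); assumption?; simp)+
qed

end

theorem theorem3p3:
  fixes d m n :: nat and T :: "nat set set"
  assumes "d \<ge> 3"
    and "n = d + m * (d - 2)"
    and "d_angulation d n T"
  shows "label_matrix n T = path_matrix d n T
    \<and> transpose_mat (label_matrix n T) = label_matrix n T"
proof -
  interpret polygon_angulation n T d
    using assms by unfold_locales (auto simp: d_angulation_def)
  \<comment> \<open>Symmetry: the label of \<open>j\<close> from \<open>i\<close> also counts the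
    paths from \<open>j\<close> to \<open>i\<close>, which is the label of \<open>i\<close> from
    \<open>j\<close>.\<close>
  have "label n T (Suc i) (Suc j) = num_paths (Suc i) (Suc j)"
    "label n T (Suc j) (Suc i) = label n T (Suc i) (Suc j)" if "i < n" "j < n" for i j
    using label_eq_num_paths[of "Suc i" "Suc j"] label_eq_num_paths[of "Suc j" "Suc i"] that by auto
  then show ?thesis
    by (auto simp: label_matrix_def path_matrix_def d_paths_eq_assignments intro!: eq_matI)
qed

end
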